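(* Two forests $F_1$ and $F_2$ are isomorphic as graphs if and only if their isotropic matroids $M[IAS(F_1)]$ and $M[IAS(F_2)]$ are isomorphic as matroids.
   Context: A forest is a finite simple graph (no loops, no multiple edges) without cycles. For a finite graph $G$ without multiple edges (and with at most one loop per vertex), $A(G)$ is the $V(G)\times V(G)$ adjacency matrix over $GF(2)$ (diagonal entry $1$ exactly at looped vertices, off-diagonal entry $1$ exactly for adjacent distinct vertices). $IAS(G)$ is the $GF(2)$-matrix $(I\mid A(G)\mid A(G)+I)$ with rows indexed by $V(G)$; for $v\in V(G)$ the $v$-columns of the three blocks are labelled $\phi_G(v),\chi_G(v),\psi_G(v)$. The isotropic matroid $M[IAS(G)]$ is the binary column matroid of $IAS(G)$, with ground set $W(G)=\{\phi_G(v),\chi_G(v),\psi_G(v): v\in V(G)\}$. *)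

theory Defs
  imports Main "HOL-Library.Z2"
begin

definition simple_graph :: "'a set \<Rightarrow> ('a \<Rightarrow> 'a \<Rightarrow> bool) \<Rightarrow> bool" where
  "simple_graph V E \<longleftrightarrow> finite V \<and> (\<forall>u v. E u v \<longrightarrow> u \<in> V \<and> v \<in> V)
     \<and> (\<forall>u v. E u v \<longrightarrow> E v u) \<and> (\<forall>v. \<not> E v v)"

definition is_cycle :: "'a set \<Rightarrow> ('a \<Rightarrow> 'a \<Rightarrow> bool) \<Rightarrow> 'a list \<Rightarrow> bool" where
  "is_cycle V E cs \<longleftrightarrow> length cs \<ge> 3 \<and> distinct cs \<and> set cs \<subseteq> V
     \<and> (\<forall>i. Suc i < length cs \<longrightarrow> E (cs ! i) (cs ! Suc i))
     \<and> E (last cs) (hd cs)"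

definition forest :: "'a set \<Rightarrow> ('a \<Rightarrow> 'a \<Rightarrow> bool) \<Rightarrow> bool" where
  "forest V E \<longleftrightarrow> simple_graph V E \<and> (\<nexists>cs. is_cycle V E cs)"

definition graph_iso ::
  "'a set \<Rightarrow> ('a \<Rightarrow> 'a \<Rightarrow> bool) \<Rightarrow> 'b set \<Rightarrow> ('b \<Rightarrow> 'b \<Rightarrow> bool) \<Rightarrow> bool" where
  "graph_iso V1 E1 V2 E2 \<longleftrightarrow> (\<exists>f. bij_betw f V1 V2 \<and>
     (\<forall>u\<in>V1. \<forall>v\<in>V1. E1 u v \<longleftrightarrow> E2 (f u) (f v)))"

datatype 'a welem = Phi 'a | Chi 'a | Psi 'a

definition W :: "'a set \<Rightarrow> 'a welem set" where
  "W V = Phi ` V \<union> Chi ` V \<union> Psi ` V"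

definition adj :: "('a \<Rightarrow> 'a \<Rightarrow> bool) \<Rightarrow> 'a \<Rightarrow> 'a \<Rightarrow> bit" where
  "adj E u v = (if E u v then 1 else 0)"

definition idm :: "'a \<Rightarrow> 'a \<Rightarrow> bit" where
  "idm u v = (if u = v then 1 else 0)"

text \<open>The column of IAS(G) = (I | A(G) | A(G)+I) labelled by x, as a function
  of the row index.\<close>

fun IAS_col :: "('a \<Rightarrow> 'a \<Rightarrow> bool) \<Rightarrow> 'a welem \<Rightarrow> 'a \<Rightarrow> bit" where
  "IAS_col E (Phi v) = (\<lambda>u. idm u v)"
| "IAS_col E (Chi v) = (\<lambda>u. adj E u v)"
| "IAS_col E (Psi v) = (\<lambda>u. adj E u v + idm u v)"

definition IAS_indep :: "'a set \<Rightarrow> ('a \<Rightarrow> 'a \<Rightarrow> bool) \<Rightarrow> 'a welem set \<Rightarrow> bool" where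
  "IAS_indep V E S \<longleftrightarrow> S \<subseteq> W V \<and>
     (\<forall>c :: 'a welem \<Rightarrow> bit. (\<forall>u\<in>V. (\<Sum>x\<in>S. c x * IAS_col E x u) = 0)
        \<longrightarrow> (\<forall>x\<in>S. c x = 0))"

definition matroid_iso ::
  "'a set \<Rightarrow> ('a set \<Rightarrow> bool) \<Rightarrow> 'b set \<Rightarrow> ('b set \<Rightarrow> bool) \<Rightarrow> bool" where
  "matroid_iso G1 I1 G2 I2 \<longleftrightarrow> (\<exists>g. bij_betw g G1 G2 \<and>
     (\<forall>S. S \<subseteq> G1 \<longrightarrow> (I1 S \<longleftrightarrow> I2 (g ` S))))"

end

theory Submission
  imports Defs
begin

text \<open>
  A matroid isomorphism of binary matroids is a bijection \<open>g\<close> of the ground sets that preserves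
  the column sets with zero sum, hence also their orthogonal complement, the cocycles. In a
  forest the cocycles with two or four elements are all caused by isolated vertices, components
  with a single edge, and leaves: a leaf \<open>l\<close> at \<open>w\<close> gives the cocycle
  \<open>\<phi>(l), \<psi>(l), \<chi>(w), \<psi>(w)\<close>, and two leaves \<open>l, l'\<close> at the same vertex
  give \<open>\<phi>(l), \<psi>(l), \<phi>(l'), \<psi>(l')\<close>. Following such a cocycle under \<open>g\<close>, one composes
  \<open>g\<close> with automorphisms of the second matroid (pivots, local complementations, exchanges of
  parallel elements) until it carries the elements of \<open>l\<close> to those of a leaf \<open>l'\<close> at \<open>w'\<close>, the
  element \<open>\<phi>(w)\<close> to \<open>\<phi>(w')\<close>, and \<open>{\<chi>(w), \<psi>(w)}\<close> to \<open>{\<chi>(w'), \<psi>(w')}\<close>. Then \<open>l\<close> and \<open>l'\<close> are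
  deleted, and the induction hypothesis must produce an isomorphism with \<open>w \<mapsto> w'\<close>. So the
  induction is over the stronger claim that the graph isomorphism can be chosen to send
  \<open>v\<close> to \<open>v'\<close> whenever \<open>g\<close> maps \<open>\<phi>(v)\<close> to \<open>\<phi>(v')\<close> and \<open>{\<chi>(v), \<psi>(v)}\<close> to
  \<open>{\<chi>(v'), \<psi>(v')}\<close>. The only obstruction to aligning \<open>g\<close> is an extra symmetry of the path on
  four vertices.
\<close>

section \<open>Zero-sum sets and cocycles\<close>

definition bit_of :: "bool \<Rightarrow> bit" where
  "bit_of b = (if b then 1 else 0)"

lemma bit_of_simps [simp]:
  "bit_of b = 0 \<longleftrightarrow> \<not> b" "bit_of b = 1 \<longleftrightarrow> b" "bit_of b = bit_of c \<longleftrightarrow> b = c"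
  "bit_of b + bit_of c = bit_of (b \<noteq> c)" "bit_of True = 1" "bit_of False = 0"
  by (auto simp: bit_of_def)

lemma bit_add_eq_0_iff: "(a::bit) + b = 0 \<longleftrightarrow> a = b"
  by (cases a; cases b) auto

lemma sum_bit_of:
  assumes "finite A"
  shows "(\<Sum>u\<in>A. bit_of (P u)) = bit_of (odd (card {u \<in> A. P u}))"
  using assms
proof (induction A)
  case (insert a A)
  have "{u \<in> insert a A. P u} = (if P a then insert a {u \<in> A. P u} else {u \<in> A. P u})"
    by auto
  then show ?case using insert by (auto simp: bit_of_def)
qed simp

text \<open>Unlike in \<^const>\<open>forest\<close>, the relation is unconstrained outside \<^term>\<open>V\<close>, so that
  vertices can be deleted without changing it.\<close>

definition acyclic_on :: "'a set \<Rightarrow> ('a \<Rightarrow> 'a \<Rightarrow> bool) \<Rightarrow> bool" where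
  "acyclic_on V E \<longleftrightarrow> finite V \<and> (\<forall>u\<in>V. \<forall>v\<in>V. E u v \<longrightarrow> E v u) \<and> (\<forall>v\<in>V. \<not> E v v)
     \<and> (\<nexists>cs. is_cycle V E cs)"

text \<open>Over GF(2) this is membership in the cycle space of the matroid, whose members are the
  disjoint unions of circuits.\<close>

definition zero_sum :: "'a set \<Rightarrow> ('a \<Rightarrow> 'a \<Rightarrow> bool) \<Rightarrow> 'a welem set \<Rightarrow> bool" where
  "zero_sum V E S \<longleftrightarrow> (\<forall>u\<in>V. (\<Sum>x\<in>S. IAS_col E x u) = 0)"

definition cycle_iso where
  "cycle_iso V1 E1 V2 E2 g \<longleftrightarrow> bij_betw g (W V1) (W V2)
     \<and> (\<forall>S. S \<subseteq> W V1 \<longrightarrow> (zero_sum V1 E1 S \<longleftrightarrow> zero_sum V2 E2 (g ` S)))"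

definition nbrs :: "'a set \<Rightarrow> ('a \<Rightarrow> 'a \<Rightarrow> bool) \<Rightarrow> 'a \<Rightarrow> 'a set" where
  "nbrs V E v = {u\<in>V. E u v}"

text \<open>A column over GF(2) is read as a set, so that adding columns becomes taking symmetric
  differences.\<close>

definition supp :: "'a set \<Rightarrow> ('a \<Rightarrow> 'a \<Rightarrow> bool) \<Rightarrow> 'a welem \<Rightarrow> 'a set" where
  "supp V E x = {u\<in>V. IAS_col E x u = 1}"

text \<open>Orthogonality to the cycle space, expressed as an even intersection with every zero-sum
  set. Such sets form the row space of the matrix.\<close>

definition cocycle :: "'a set \<Rightarrow> ('a \<Rightarrow> 'a \<Rightarrow> bool) \<Rightarrow> 'a welem set \<Rightarrow> bool" where
  "cocycle V E D \<longleftrightarrow> D \<subseteq> W V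
     \<and> (\<forall>S. S \<subseteq> W V \<longrightarrow> zero_sum V E S \<longrightarrow> (\<Sum>x\<in>S. bit_of (x \<in> D)) = 0)"

lemma acyclic_onD:
  assumes "acyclic_on V E"
  shows "finite V" "\<And>u v. u \<in> V \<Longrightarrow> v \<in> V \<Longrightarrow> E u v \<longleftrightarrow> E v u" "\<And>v. v \<in> V \<Longrightarrow> \<not> E v v"
  using assms unfolding acyclic_on_def by blast+

lemma acyclic_on_no_triangle:
  assumes "acyclic_on V E" "a \<in> V" "b \<in> V" "c \<in> V" "E a b" "E b c" "E c a"
  shows False
proof -
  have "distinct [a, b, c]" using assms acyclic_onD(3)[OF assms(1)] by auto
  then have "is_cycle V E [a, b, c]"
    using assms unfolding is_cycle_def by (auto simp: less_Suc_eq)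
  then show False using assms(1) unfolding acyclic_on_def by blast
qed

lemma acyclic_on_no_square:
  assumes "acyclic_on V E" "a \<in> V" "b \<in> V" "c \<in> V" "d \<in> V"
    "E a b" "E b c" "E c d" "E d a" "a \<noteq> c"
  shows "b = d"
proof (rule ccontr)
  assume "b \<noteq> d"
  then have "distinct [a, b, c, d]" using assms acyclic_onD(3)[OF assms(1)] by auto
  then have "is_cycle V E [a, b, c, d]"
    using assms unfolding is_cycle_def by (auto simp: less_Suc_eq)
  then show False using assms(1) unfolding acyclic_on_def by blast
qed

lemma acyclic_on_subset:
  assumes "acyclic_on V E" "U \<subseteq> V"
  shows "acyclic_on U E"
proof -
  have "is_cycle V E cs" if "is_cycle U E cs" for cs
    using that assms(2) unfolding is_cycle_def by auto
  then show ?thesis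
    using assms unfolding acyclic_on_def by (meson finite_subset subsetD)
qed

section \<open>Columns as sets of rows\<close>

lemma W_memb [simp]:
  "Phi v \<in> W V \<longleftrightarrow> v \<in> V" "Chi v \<in> W V \<longleftrightarrow> v \<in> V" "Psi v \<in> W V \<longleftrightarrow> v \<in> V"
  by (auto simp: W_def)

lemma finite_W: "finite V \<Longrightarrow> finite (W V)"
  by (simp add: W_def)

lemma card_W:
  assumes "finite V"
  shows "card (W V) = 3 * card V"
proof -
  have c: "card (Phi ` V) = card V" "card (Chi ` V) = card V" "card (Psi ` V) = card V"
    by (auto intro!: card_image inj_onI)
  have "card (Phi ` V \<union> Chi ` V) = 2 * card V"
    using assms c by (subst card_Un_disjoint) auto
  then show ?thesis
    unfolding W_def using assms c by (subst card_Un_disjoint) auto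
qed

lemma W_mono: "U \<subseteq> V \<Longrightarrow> W U \<subseteq> W V"
  by (auto simp: W_def)

lemma W_Diff: "W (V - U) = W V - W U"
  by (auto simp: W_def)

lemma W_cases:
  assumes "x \<in> W V"
  obtains v where "v \<in> V" "x = Phi v" | v where "v \<in> V" "x = Chi v" | v where "v \<in> V" "x = Psi v"
  using assms by (auto simp: W_def)

lemma supp_Phi: "v \<in> V \<Longrightarrow> supp V E (Phi v) = {v}"
  by (auto simp: supp_def idm_def)

lemma supp_Chi: "supp V E (Chi v) = nbrs V E v"
  by (auto simp: supp_def nbrs_def adj_def)

lemma supp_Psi:
  assumes "acyclic_on V E" "v \<in> V"
  shows "supp V E (Psi v) = insert v (nbrs V E v)"
  using assms acyclic_onD(3)[OF assms(1)]
  by (auto simp: supp_def nbrs_def adj_def idm_def split: if_splits)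

lemma IAS_col_bit_of: "u \<in> V \<Longrightarrow> IAS_col E x u = bit_of (u \<in> supp V E x)"
  by (cases "IAS_col E x u") (auto simp: supp_def bit_of_def)

lemma supp_subset: "supp V E x \<subseteq> V"
  by (auto simp: supp_def)

lemma zero_sum_pair:
  assumes "x \<noteq> y"
  shows "zero_sum V E {x, y} \<longleftrightarrow> supp V E x = supp V E y"
proof -
  have "zero_sum V E {x, y} \<longleftrightarrow> (\<forall>u\<in>V. IAS_col E x u = IAS_col E y u)"
    unfolding zero_sum_def using assms by (auto simp: bit_add_eq_0_iff)
  also have "\<dots> \<longleftrightarrow> supp V E x = supp V E y"
    by (auto simp: IAS_col_bit_of set_eq_iff) (metis subsetD supp_subset)+
  finally show ?thesis .
qed

lemma zero_sum_single: "zero_sum V E {x} \<longleftrightarrow> supp V E x = {}"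
  unfolding zero_sum_def supp_def by auto

lemma zero_sum_triple:
  assumes "x \<noteq> y" "x \<noteq> z" "y \<noteq> z"
  shows "zero_sum V E {x, y, z} \<longleftrightarrow> supp V E z = sym_diff (supp V E x) (supp V E y)"
proof -
  have "zero_sum V E {x, y, z} \<longleftrightarrow>
      (\<forall>u\<in>V. u \<in> supp V E z \<longleftrightarrow> (u \<in> supp V E x) \<noteq> (u \<in> supp V E y))"
    unfolding zero_sum_def using assms by (auto simp: IAS_col_bit_of)
  also have "\<dots> \<longleftrightarrow> supp V E z = sym_diff (supp V E x) (supp V E y)"
    using supp_subset[of V E] by blast
  finally show ?thesis .
qed

lemma nbrs_sym:
  assumes "acyclic_on V E" "u \<in> V" "v \<in> V"
  shows "u \<in> nbrs V E v \<longleftrightarrow> v \<in> nbrs V E u"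
  using assms acyclic_onD(2)[OF assms(1)] by (auto simp: nbrs_def)

lemma nbrs_irrefl: "acyclic_on V E \<Longrightarrow> v \<notin> nbrs V E v"
  by (auto simp: nbrs_def acyclic_on_def)

lemma nbrs_subset: "nbrs V E v \<subseteq> V"
  by (auto simp: nbrs_def)

section \<open>Cocycles are determined by their \<open>Phi\<close> elements\<close>

lemma zero_sum_triangle:
  assumes "acyclic_on V E" "v \<in> V"
  shows "zero_sum V E {Phi v, Chi v, Psi v}"
  using nbrs_irrefl[OF assms(1), of v] assms
  by (subst zero_sum_triple) (auto simp: supp_Phi supp_Chi supp_Psi)

text \<open>The unit columns at the neighbours of \<open>v\<close> add up to the adjacency column of
  \<open>v\<close>. The structure of cocycles is derived from these sets and the triangles
  alone.\<close>

lemma zero_sum_star: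
  assumes "acyclic_on V E" "v \<in> V"
  shows "zero_sum V E (insert (Chi v) (Phi ` nbrs V E v))"
  unfolding zero_sum_def
proof
  fix u assume u: "u \<in> V"
  have fin: "finite (nbrs V E v)"
    using acyclic_onD(1)[OF assms(1)] by (simp add: nbrs_def)
  have "(\<Sum>x\<in>Phi ` nbrs V E v. IAS_col E x u) = (\<Sum>w\<in>nbrs V E v. idm u w)"
    by (subst sum.reindex) (auto intro: inj_onI)
  also have "\<dots> = bit_of (u \<in> nbrs V E v)"
    using fin by (simp add: idm_def bit_of_def)
  finally have s: "(\<Sum>x\<in>Phi ` nbrs V E v. IAS_col E x u) = bit_of (u \<in> nbrs V E v)" .
  have "(\<Sum>x\<in>insert (Chi v) (Phi ` nbrs V E v). IAS_col E x u)
      = IAS_col E (Chi v) u + (\<Sum>x\<in>Phi ` nbrs V E v. IAS_col E x u)"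
    using fin by (subst sum.insert) auto
  then show "(\<Sum>x\<in>insert (Chi v) (Phi ` nbrs V E v). IAS_col E x u) = 0"
    using u by (simp only: s IAS_col_bit_of[OF u, of E "Chi v"] supp_Chi bit_add_eq_0_iff)
qed

lemma cocycle_Psi_iff:
  assumes "acyclic_on V E" "cocycle V E D" "v \<in> V"
  shows "Psi v \<in> D \<longleftrightarrow> (Phi v \<in> D) \<noteq> (Chi v \<in> D)"
proof -
  have "(\<Sum>x\<in>{Phi v, Chi v, Psi v}. bit_of (x \<in> D)) = 0"
    using assms(2,3) zero_sum_triangle[OF assms(1,3)]
    unfolding cocycle_def by (meson W_memb empty_subsetI insert_subset)
  then show ?thesis
    by (auto split: if_splits)
qed

lemma cocycle_Chi_iff:
  assumes "acyclic_on V E" "cocycle V E D" "v \<in> V"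
  shows "Chi v \<in> D \<longleftrightarrow> odd (card {u \<in> nbrs V E v. Phi u \<in> D})"
proof -
  have fin: "finite (nbrs V E v)"
    using acyclic_onD(1)[OF assms(1)] by (simp add: nbrs_def)
  have "insert (Chi v) (Phi ` nbrs V E v) \<subseteq> W V"
    using assms(3) nbrs_subset[of V E v] by auto
  then have "(\<Sum>x\<in>insert (Chi v) (Phi ` nbrs V E v). bit_of (x \<in> D)) = 0"
    using assms(2) zero_sum_star[OF assms(1,3)] unfolding cocycle_def by blast
  moreover have "(\<Sum>x\<in>insert (Chi v) (Phi ` nbrs V E v). bit_of (x \<in> D))
      = bit_of (Chi v \<in> D) + (\<Sum>x\<in>Phi ` nbrs V E v. bit_of (x \<in> D))"
    using fin by (subst sum.insert) auto
  moreover have "(\<Sum>x\<in>Phi ` nbrs V E v. bit_of (x \<in> D))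
      = (\<Sum>u\<in>nbrs V E v. bit_of (Phi u \<in> D))"
    by (subst sum.reindex) (auto intro: inj_onI)
  ultimately have "bit_of (Chi v \<in> D) = bit_of (odd (card {u \<in> nbrs V E v. Phi u \<in> D}))"
    by (simp only: sum_bit_of[OF fin] bit_add_eq_0_iff)
  then show ?thesis by simp
qed

text \<open>By the two parity rules above, the \<open>Phi\<close> elements of a cocycle determine
  it: they name the rows whose sum it is. Without any of them nothing remains.\<close>

lemma cocycle_has_Phi:
  assumes "acyclic_on V E" "cocycle V E D" "D \<noteq> {}"
  obtains a where "a \<in> V" "Phi a \<in> D"
proof -
  obtain x where x: "x \<in> D" "x \<in> W V" using assms unfolding cocycle_def by blast
  have "\<exists>a\<in>V. Phi a \<in> D"
  proof (rule ccontr)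
    assume no: "\<not> ?thesis"
    then have "Chi v \<notin> D" if "v \<in> V" for v
      using cocycle_Chi_iff[OF assms(1,2) that] nbrs_subset[of V E v]
      by (metis (no_types, lifting) Collect_empty_eq card.empty even_zero subsetD)
    with no x cocycle_Psi_iff[OF assms(1,2)] show False by (auto simp: W_def)
  qed
  then show ?thesis using that by blast
qed

text \<open>Row \<open>a\<close> of the matrix is orthogonal to every zero-sum set, because the sum
  of such a set vanishes in row \<open>a\<close>.\<close>

lemma row_cocycle:
  assumes "acyclic_on V E" "a \<in> V"
  shows "cocycle V E {x \<in> W V. a \<in> supp V E x}"
  unfolding cocycle_def
proof (intro conjI allI impI)
  fix S assume S: "S \<subseteq> W V" "zero_sum V E S"
  have "(\<Sum>x\<in>S. bit_of (x \<in> {x \<in> W V. a \<in> supp V E x}) :: bit) = (\<Sum>x\<in>S. IAS_col E x a)"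
    using S(1) assms(2) by (intro sum.cong) (auto simp: IAS_col_bit_of)
  then show "(\<Sum>x\<in>S. bit_of (x \<in> {x \<in> W V. a \<in> supp V E x})) = 0"
    using S(2) assms(2) unfolding zero_sum_def by simp
qed auto

section \<open>Isomorphisms of cycle spaces\<close>

lemma cycle_isoD:
  assumes "cycle_iso V1 E1 V2 E2 g"
  shows "bij_betw g (W V1) (W V2)" "inj_on g (W V1)" "g ` W V1 = W V2"
    "\<And>x. x \<in> W V1 \<Longrightarrow> g x \<in> W V2"
    "\<And>S. S \<subseteq> W V1 \<Longrightarrow> zero_sum V2 E2 (g ` S) \<longleftrightarrow> zero_sum V1 E1 S"
  using assms by (auto simp: cycle_iso_def bij_betw_def)

lemma cycle_iso_eq_iff:
  assumes "cycle_iso V1 E1 V2 E2 g" "x \<in> W V1" "y \<in> W V1"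
  shows "g x = g y \<longleftrightarrow> x = y"
  using cycle_isoD(2)[OF assms(1)] assms(2,3) by (auto dest: inj_onD)

lemma cycle_iso_inv:
  assumes "cycle_iso V1 E1 V2 E2 g"
  shows "cycle_iso V2 E2 V1 E1 (inv_into (W V1) g)"
proof -
  note D = cycle_isoD[OF assms]
  have "zero_sum V2 E2 S \<longleftrightarrow> zero_sum V1 E1 (inv_into (W V1) g ` S)" if S: "S \<subseteq> W V2" for S
  proof -
    have "inv_into (W V1) g ` S \<subseteq> W V1"
      using S D(3) by (metis image_subsetI inv_into_into subsetD)
    moreover have "g ` inv_into (W V1) g ` S = S"
      using S D(3) by (simp add: image_inv_into_cancel)
    ultimately show ?thesis using D(5) by metis
  qed
  then show ?thesis
    unfolding cycle_iso_def using bij_betw_inv_into[OF D(1)] by blast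
qed

lemma cycle_iso_comp:
  assumes "cycle_iso V1 E1 V2 E2 g" "cycle_iso V2 E2 V3 E3 h"
  shows "cycle_iso V1 E1 V3 E3 (h \<circ> g)"
  unfolding cycle_iso_def
proof (intro conjI allI impI)
  show "bij_betw (h \<circ> g) (W V1) (W V3)"
    using assms by (auto simp: cycle_iso_def intro: bij_betw_trans)
  fix S assume S: "S \<subseteq> W V1"
  then have "g ` S \<subseteq> W V2" using cycle_isoD(3)[OF assms(1)] by auto
  then show "zero_sum V1 E1 S \<longleftrightarrow> zero_sum V3 E3 ((h \<circ> g) ` S)"
    using cycle_isoD(5)[OF assms(1) S] cycle_isoD(5)[OF assms(2)] by (simp only: image_comp[symmetric])
qed

text \<open>Pulling a zero-sum set back along the injective map \<open>g\<close> yields a zero-sum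
  set that meets \<open>D\<close> in equally many elements.\<close>

lemma cycle_iso_cocycle:
  assumes "cycle_iso V1 E1 V2 E2 g" "cocycle V1 E1 D"
  shows "cocycle V2 E2 (g ` D)"
  unfolding cocycle_def
proof (intro conjI allI impI)
  note D = cycle_isoD[OF assms(1)]
  have DW: "D \<subseteq> W V1" using assms(2) by (simp add: cocycle_def)
  then show "g ` D \<subseteq> W V2" using D(3) by auto
  fix T assume T: "T \<subseteq> W V2" "zero_sum V2 E2 T"
  define S where "S = inv_into (W V1) g ` T"
  have S: "S \<subseteq> W V1"
    using T(1) D(3) unfolding S_def by (metis image_subsetI inv_into_into subsetD)
  have gS: "g ` S = T"
    using T(1) D(3) by (simp add: S_def image_inv_into_cancel)
  have inj: "inj_on g S" using D(2) S inj_on_subset by blast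
  have "(\<Sum>x\<in>T. bit_of (x \<in> g ` D)) = (\<Sum>x\<in>S. bit_of (g x \<in> g ` D))"
    unfolding gS[symmetric] by (subst sum.reindex[OF inj]) simp
  also have "\<dots> = (\<Sum>x\<in>S. bit_of (x \<in> D))"
  proof (rule sum.cong[OF refl])
    fix x assume "x \<in> S"
    then have "g x \<in> g ` D \<longleftrightarrow> x \<in> D" using S DW D(2) by (meson inj_on_image_mem_iff subsetD)
    then show "bit_of (g x \<in> g ` D) = bit_of (x \<in> D)" by simp
  qed
  also have "\<dots> = 0"
    using assms(2) T(2) S gS D(5)[OF S] by (auto simp: cocycle_def)
  finally show "(\<Sum>x\<in>T. bit_of (x \<in> g ` D)) = 0" .
qed

text \<open>Distinct elements have equal columns exactly when they form a zero-sum pair, which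
  \<open>g\<close> preserves.\<close>

lemma cycle_iso_supp_eq:
  assumes "cycle_iso V1 E1 V2 E2 g" "x \<in> W V1" "y \<in> W V1"
  shows "supp V2 E2 (g x) = supp V2 E2 (g y) \<longleftrightarrow> supp V1 E1 x = supp V1 E1 y"
proof (cases "x = y")
  case False
  then have "g x \<noteq> g y" using cycle_iso_eq_iff[OF assms] by simp
  then show ?thesis
    using cycle_isoD(5)[OF assms(1), of "{x, y}"] assms(2,3) False by (simp add: zero_sum_pair)
qed simp

lemma cycle_iso_supp_empty:
  assumes "cycle_iso V1 E1 V2 E2 g" "x \<in> W V1"
  shows "supp V2 E2 (g x) = {} \<longleftrightarrow> supp V1 E1 x = {}"
  using cycle_isoD(5)[OF assms(1), of "{x}"] assms(2) by (simp add: zero_sum_single)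

lemma cycle_iso_supp_sym_diff:
  assumes "cycle_iso V1 E1 V2 E2 g" "x \<in> W V1" "y \<in> W V1" "z \<in> W V1" "x \<noteq> y" "x \<noteq> z" "y \<noteq> z"
    "supp V1 E1 z = sym_diff (supp V1 E1 x) (supp V1 E1 y)"
  shows "supp V2 E2 (g z) = sym_diff (supp V2 E2 (g x)) (supp V2 E2 (g y))"
proof -
  have "g x \<noteq> g y" "g x \<noteq> g z" "g y \<noteq> g z"
    using cycle_iso_eq_iff[OF assms(1)] assms(2-7) by auto
  then show ?thesis
    using cycle_isoD(5)[OF assms(1), of "{x, y, z}"] assms(2-8) by (simp add: zero_sum_triple)
qed

text \<open>The columns of \<open>\<sigma> x\<close> are the images of those of \<open>x\<close> under the linear involution adding \<open>d\<close>
  to the vectors whose \<open>a\<close>-coordinate is 1.\<close>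

lemma transvection_cycle_iso:
  assumes bij: "bij_betw \<sigma> (W V) (W V)" and a: "a \<in> V" "a \<notin> d"
    and supp: "\<And>x. x \<in> W V \<Longrightarrow>
      supp V E (\<sigma> x) = (if a \<in> supp V E x then sym_diff (supp V E x) d else supp V E x)"
  shows "cycle_iso V E V E \<sigma>"
  unfolding cycle_iso_def
proof (intro conjI allI impI)
  fix S assume S: "S \<subseteq> W V"
  then have inj: "inj_on \<sigma> S" using bij by (meson bij_betw_imp_inj_on inj_on_subset)
  have col: "IAS_col E (\<sigma> x) u = IAS_col E x u + IAS_col E x a * bit_of (u \<in> d)"
    if "x \<in> W V" "u \<in> V" for x u
    using supp[OF that(1)] that(2) a by (auto simp: IAS_col_bit_of bit_of_def)
  have sum: "(\<Sum>x\<in>\<sigma> ` S. IAS_col E x u)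
      = (\<Sum>x\<in>S. IAS_col E x u) + (\<Sum>x\<in>S. IAS_col E x a) * bit_of (u \<in> d)" if "u \<in> V" for u
  proof -
    have "(\<Sum>x\<in>\<sigma> ` S. IAS_col E x u) = (\<Sum>x\<in>S. IAS_col E (\<sigma> x) u)"
      by (subst sum.reindex[OF inj]) simp
    also have "\<dots> = (\<Sum>x\<in>S. IAS_col E x u + IAS_col E x a * bit_of (u \<in> d))"
      using S that col by (intro sum.cong) auto
    also have "\<dots> = (\<Sum>x\<in>S. IAS_col E x u) + (\<Sum>x\<in>S. IAS_col E x a) * bit_of (u \<in> d)"
      by (simp only: sum.distrib sum_distrib_right)
    finally show ?thesis .
  qed
  \<comment> \<open>Because \<open>a\<close> is not in \<open>d\<close>, the
    \<open>a\<close>-coordinate of the sum is fixed. If either sum vanishes, so does the correction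
    term.\<close>
  have "(\<Sum>x\<in>\<sigma> ` S. IAS_col E x a) = (\<Sum>x\<in>S. IAS_col E x a)"
    using sum[OF a(1)] a(2) by simp
  then show "zero_sum V E S \<longleftrightarrow> zero_sum V E (\<sigma> ` S)"
    unfolding zero_sum_def using sum a(1) by (metis add_0_right mult_zero_left)
qed (rule bij)

section \<open>Automorphisms of the matroid near a leaf\<close>

definition leaf :: "'a set \<Rightarrow> ('a \<Rightarrow> 'a \<Rightarrow> bool) \<Rightarrow> 'a \<Rightarrow> 'a \<Rightarrow> bool" where
  "leaf V E l w \<longleftrightarrow> l \<in> V \<and> nbrs V E l = {w}"

lemma leafD:
  assumes "acyclic_on V E" "leaf V E l w"
  shows "l \<in> V" "w \<in> V" "nbrs V E l = {w}" "l \<in> nbrs V E w" "l \<noteq> w"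
proof -
  show *: "l \<in> V" "nbrs V E l = {w}" using assms(2) by (auto simp: leaf_def)
  then show w: "w \<in> V" using nbrs_subset[of V E l] by simp
  show "l \<in> nbrs V E w" using nbrs_sym[OF assms(1) *(1) w] * by simp
  then show "l \<noteq> w" using nbrs_irrefl[OF assms(1), of w] by auto
qed

definition swap :: "'b \<Rightarrow> 'b \<Rightarrow> 'b \<Rightarrow> 'b" where
  "swap x y z = (if z = x then y else if z = y then x else z)"

text \<open>For a leaf \<open>l\<close> at \<open>w\<close> these are the permutations induced by pivoting on the edge \<open>lw\<close> and
  by local complementation at \<open>l\<close>; neither changes the graph up to exchanging the names \<open>l\<close> and \<open>w\<close>.\<close>

fun pivot :: "'a \<Rightarrow> 'a \<Rightarrow> 'a welem \<Rightarrow> 'a welem" where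
  "pivot l w (Phi v) = (if v = l then Chi w else if v = w then Chi l else Phi v)"
| "pivot l w (Chi v) = (if v = l then Phi w else if v = w then Phi l else Chi v)"
| "pivot l w (Psi v) = (if v = l then Psi w else if v = w then Psi l else Psi v)"

fun local_swap :: "'a \<Rightarrow> 'a \<Rightarrow> 'a welem \<Rightarrow> 'a welem" where
  "local_swap l w (Phi v) = (if v = l then Psi l else Phi v)"
| "local_swap l w (Chi v) = (if v = w then Psi w else Chi v)"
| "local_swap l w (Psi v) = (if v = l then Phi l else if v = w then Chi w else Psi v)"

lemma swap_bij:
  assumes "x \<in> A" "y \<in> A"
  shows "bij_betw (swap x y) A A"
  by (rule bij_betw_byWitness[where f' = "swap x y"]) (use assms in \<open>auto simp: swap_def\<close>)

text \<open>Exchanging elements with equal columns is the case \<open>d = {}\<close> of the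
  transvection lemma, where \<open>a\<close> may be any vertex.\<close>

lemma swap_cycle_iso:
  assumes "x \<in> W V" "y \<in> W V" "supp V E x = supp V E y"
  shows "cycle_iso V E V E (swap x y)"
proof -
  obtain a where "a \<in> V" using assms(1) by (auto simp: W_def)
  then show ?thesis
    using swap_bij[OF assms(1,2)] assms(3)
    by (intro transvection_cycle_iso[where d = "{}" and a = a]) (auto simp: swap_def)
qed

text \<open>The columns containing \<open>l\<close> are those of \<open>Phi l\<close>,
  \<open>Psi l\<close>, \<open>Chi w\<close> and \<open>Psi w\<close>. Adding
  \<open>nbrs V E w - {l}\<close> to them exchanges \<open>Phi l\<close> with \<open>Chi w\<close>
  and \<open>Psi l\<close> with \<open>Psi w\<close>, while \<open>Chi l\<close> and
  \<open>Phi w\<close> have equal columns anyway.\<close>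

lemma pivot_cycle_iso:
  assumes "acyclic_on V E" "leaf V E l w"
  shows "cycle_iso V E V E (pivot l w)"
proof (rule transvection_cycle_iso[where a = l and d = "nbrs V E w - {l}"])
  note L = leafD[OF assms]
  have W: "pivot l w x \<in> W V \<and> pivot l w (pivot l w x) = x" if "x \<in> W V" for x
    using that L by (cases x) auto
  show "bij_betw (pivot l w) (W V) (W V)"
    by (rule bij_betw_byWitness[where f' = "pivot l w"]) (use W in auto)
  have nb: "l \<in> nbrs V E v \<longleftrightarrow> v = w" if "v \<in> V" for v
    using nbrs_sym[OF assms(1) L(1) that] L(3) by auto
  have ww: "w \<notin> nbrs V E w" using nbrs_irrefl[OF assms(1)] .
  have S: "supp V E (Phi v) = {v}" "supp V E (Chi v) = nbrs V E v"
    "supp V E (Psi v) = insert v (nbrs V E v)" if "v \<in> V" for v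
    using that by (auto simp: supp_Phi supp_Chi supp_Psi[OF assms(1)])
  show "supp V E (pivot l w x) = (if l \<in> supp V E x then
     sym_diff (supp V E x) (nbrs V E w - {l}) else supp V E x)" if x: "x \<in> W V" for x
    using x
  proof (cases rule: W_cases)
    case (1 v)
    then show ?thesis using L ww nb by (cases "v = l"; cases "v = w") (auto simp: S)
  next
    case (2 v)
    then show ?thesis using L ww nb by (cases "v = l"; cases "v = w") (auto simp: S)
  next
    case (3 v)
    then show ?thesis using L ww nb by (cases "v = l"; cases "v = w") (auto simp: S)
  qed
qed (use leafD[OF assms] in auto)

text \<open>Adding the unit vector at \<open>w\<close> to the same four columns exchanges
  \<open>Phi l\<close> with \<open>Psi l\<close> and \<open>Chi w\<close> with
  \<open>Psi w\<close>.\<close>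

lemma local_swap_cycle_iso:
  assumes "acyclic_on V E" "leaf V E l w"
  shows "cycle_iso V E V E (local_swap l w)"
proof (rule transvection_cycle_iso[where a = l and d = "{w}"])
  note L = leafD[OF assms]
  have W: "local_swap l w x \<in> W V \<and> local_swap l w (local_swap l w x) = x" if "x \<in> W V" for x
    using that L by (cases x) auto
  show "bij_betw (local_swap l w) (W V) (W V)"
    by (rule bij_betw_byWitness[where f' = "local_swap l w"]) (use W in auto)
  have nb: "l \<in> nbrs V E v \<longleftrightarrow> v = w" if "v \<in> V" for v
    using nbrs_sym[OF assms(1) L(1) that] L(3) by auto
  have ww: "w \<notin> nbrs V E w" using nbrs_irrefl[OF assms(1)] .
  have S: "supp V E (Phi v) = {v}" "supp V E (Chi v) = nbrs V E v"
    "supp V E (Psi v) = insert v (nbrs V E v)" if "v \<in> V" for v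
    using that by (auto simp: supp_Phi supp_Chi supp_Psi[OF assms(1)])
  show "supp V E (local_swap l w x) = (if l \<in> supp V E x then
     sym_diff (supp V E x) ({w}) else supp V E x)" if x: "x \<in> W V" for x
    using x
  proof (cases rule: W_cases)
    case (1 v)
    then show ?thesis using L ww nb by (cases "v = l"; cases "v = w") (auto simp: S)
  next
    case (2 v)
    then show ?thesis using L ww nb by (cases "v = l"; cases "v = w") (auto simp: S)
  next
    case (3 v)
    then show ?thesis using L ww nb by (cases "v = l"; cases "v = w") (auto simp: S)
  qed
qed (use leafD[OF assms] in auto)

section \<open>Deleting a vertex or a union of components\<close>

text \<open>Dropping row \<open>l\<close> contracts \<open>Phi l\<close>: a sum that vanishes in all
  other rows is either zero or the unit vector at \<open>l\<close>.\<close>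

lemma zero_sum_remove_vertex:
  assumes "finite V" "l \<in> V" "S \<subseteq> W (V - {l})"
  shows "zero_sum (V - {l}) E S \<longleftrightarrow> zero_sum V E S \<or> zero_sum V E (insert (Phi l) S)"
proof -
  have fin: "finite S" using assms finite_W by (metis finite_Diff finite_subset)
  have "Phi l \<notin> S" using assms(3) by auto
  then have ins: "(\<Sum>x\<in>insert (Phi l) S. IAS_col E x u) = idm u l + (\<Sum>x\<in>S. IAS_col E x u)" for u
    using fin by simp
  have "idm l l + (\<Sum>x\<in>S. IAS_col E x l) = 0 \<longleftrightarrow> (\<Sum>x\<in>S. IAS_col E x l) \<noteq> 0"
    by (cases "\<Sum>x\<in>S. IAS_col E x l") (auto simp: idm_def)
  moreover have "idm u l = 0" if "u \<noteq> l" for u using that by (simp add: idm_def)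
  ultimately show ?thesis
    unfolding zero_sum_def ins using assms(2) by (metis DiffE DiffI add_0 insert_iff singletonD)
qed

lemma cycle_iso_restrict_bij:
  assumes "cycle_iso V1 E1 V2 E2 g" "g ` W K1 = W K2" "K1 \<subseteq> V1"
  shows "bij_betw g (W (V1 - K1)) (W (V2 - K2))"
proof -
  note D = cycle_isoD[OF assms(1)]
  have "g ` (W V1 - W K1) = W V2 - W K2"
    using inj_on_image_set_diff[OF D(2), of "W V1" "W K1"] D(3) W_mono[OF assms(3)] assms(2) by auto
  then show ?thesis
    unfolding W_Diff using D(2) by (metis Diff_subset bij_betw_def inj_on_subset)
qed

text \<open>The smaller matroid arises by contracting \<open>Phi l\<close> and deleting
  \<open>Chi l\<close> and \<open>Psi l\<close>; \<open>g\<close> carries this minor to the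
  corresponding one.\<close>

lemma cycle_iso_remove_vertex:
  assumes "cycle_iso V1 E1 V2 E2 g" "finite V1" "finite V2" "l \<in> V1" "l' \<in> V2"
    "g (Phi l) = Phi l'" "g ` W {l} = W {l'}"
  shows "cycle_iso (V1 - {l}) E1 (V2 - {l'}) E2 g"
  unfolding cycle_iso_def
proof (intro conjI allI impI)
  note D = cycle_isoD[OF assms(1)]
  show bij: "bij_betw g (W (V1 - {l})) (W (V2 - {l'}))"
    using cycle_iso_restrict_bij[OF assms(1,7)] assms(4) by simp
  fix S assume S: "S \<subseteq> W (V1 - {l})"
  then have gS: "g ` S \<subseteq> W (V2 - {l'})" using bij by (auto simp: bij_betw_def)
  have SW: "S \<subseteq> W V1" using S W_mono[of "V1 - {l}" V1] by auto
  show "zero_sum (V1 - {l}) E1 S \<longleftrightarrow> zero_sum (V2 - {l'}) E2 (g ` S)"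
    using zero_sum_remove_vertex[OF assms(2,4) S] zero_sum_remove_vertex[OF assms(3,5) gS]
      D(5)[OF SW] D(5)[of "insert (Phi l) S"] SW assms(4,6) by simp
qed

text \<open>A union of connected components.\<close>

definition closed_part :: "'a set \<Rightarrow> ('a \<Rightarrow> 'a \<Rightarrow> bool) \<Rightarrow> 'a set \<Rightarrow> bool" where
  "closed_part V E K \<longleftrightarrow> K \<subseteq> V \<and> (\<forall>u\<in>K. nbrs V E u \<subseteq> K)"

lemma closed_partD:
  assumes "acyclic_on V E" "closed_part V E K" "u \<in> K" "v \<in> V - K"
  shows "\<not> E u v" "\<not> E v u"
  using assms acyclic_onD(2)[OF assms(1)] unfolding closed_part_def nbrs_def by blast+

text \<open>Columns from outside \<open>K\<close> vanish in the rows of \<open>K\<close>, so those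
  rows impose no condition.\<close>

lemma zero_sum_remove_part:
  assumes "acyclic_on V E" "closed_part V E K" "S \<subseteq> W (V - K)"
  shows "zero_sum (V - K) E S \<longleftrightarrow> zero_sum V E S"
proof -
  have "IAS_col E x u = 0" if u: "u \<in> K" and x: "x \<in> W (V - K)" for x u
    using x
  proof (cases rule: W_cases)
    case (1 v)
    then show ?thesis using u by (auto simp: idm_def)
  next
    case (2 v)
    then show ?thesis using u closed_partD[OF assms(1,2)] by (auto simp: adj_def)
  next
    case (3 v)
    then show ?thesis using u closed_partD[OF assms(1,2)] by (auto simp: adj_def idm_def)
  qed
  then have "(\<Sum>x\<in>S. IAS_col E x u) = 0" if "u \<in> K" for u
    using that assms(3) by (intro sum.neutral) auto
  then show ?thesis unfolding zero_sum_def by blast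
qed

lemma cycle_iso_remove_part:
  assumes "cycle_iso V1 E1 V2 E2 g" "acyclic_on V1 E1" "acyclic_on V2 E2"
    "closed_part V1 E1 K1" "closed_part V2 E2 K2" "g ` W K1 = W K2"
  shows "cycle_iso (V1 - K1) E1 (V2 - K2) E2 g"
  unfolding cycle_iso_def
proof (intro conjI allI impI)
  show bij: "bij_betw g (W (V1 - K1)) (W (V2 - K2))"
    using cycle_iso_restrict_bij[OF assms(1,6)] assms(4) by (simp add: closed_part_def)
  fix S assume S: "S \<subseteq> W (V1 - K1)"
  then have gS: "g ` S \<subseteq> W (V2 - K2)" using bij by (auto simp: bij_betw_def)
  have "S \<subseteq> W V1" using S W_mono[of "V1 - K1" V1] by auto
  then show "zero_sum (V1 - K1) E1 S \<longleftrightarrow> zero_sum (V2 - K2) E2 (g ` S)"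
    using zero_sum_remove_part[OF assms(2,4) S] zero_sum_remove_part[OF assms(3,5) gS]
      cycle_isoD(5)[OF assms(1)] by simp
qed

section \<open>Graph isomorphisms realizing a cycle space isomorphism\<close>

text \<open>\<open>Chi\<close> and \<open>Psi\<close> enter as an unordered pair because local
  complementation at a leaf attached to \<open>v'\<close> exchanges them.\<close>

definition keeps :: "('a welem \<Rightarrow> 'b welem) \<Rightarrow> 'a \<Rightarrow> 'b \<Rightarrow> bool" where
  "keeps g v v' \<longleftrightarrow> g (Phi v) = Phi v' \<and> {g (Chi v), g (Psi v)} = {Chi v', Psi v'}"

definition realizes where
  "realizes V1 E1 V2 E2 g f \<longleftrightarrow> bij_betw f V1 V2
     \<and> (\<forall>u\<in>V1. \<forall>v\<in>V1. E1 u v \<longleftrightarrow> E2 (f u) (f v))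
     \<and> (\<forall>v\<in>V1. \<forall>v'\<in>V2. keeps g v v' \<longrightarrow> f v = v')"

lemma realizes_combine:
  assumes "acyclic_on V1 E1" "acyclic_on V2 E2" "cycle_iso V1 E1 V2 E2 g"
    "closed_part V1 E1 K1" "closed_part V2 E2 K2" "g ` W K1 = W K2"
    "realizes K1 E1 K2 E2 g f" "realizes (V1 - K1) E1 (V2 - K2) E2 g h"
  shows "\<exists>k. realizes V1 E1 V2 E2 g k"
proof -
  define k where "k v = (if v \<in> K1 then f v else h v)" for v
  have K: "K1 \<subseteq> V1" "K2 \<subseteq> V2" using assms(4,5) by (auto simp: closed_part_def)
  have f: "bij_betw f K1 K2" "\<And>u v. u \<in> K1 \<Longrightarrow> v \<in> K1 \<Longrightarrow> E1 u v \<longleftrightarrow> E2 (f u) (f v)"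
    "\<And>v v'. v \<in> K1 \<Longrightarrow> v' \<in> K2 \<Longrightarrow> keeps g v v' \<Longrightarrow> f v = v'"
    using assms(7) by (auto simp: realizes_def)
  have h: "bij_betw h (V1 - K1) (V2 - K2)"
    "\<And>u v. u \<in> V1 - K1 \<Longrightarrow> v \<in> V1 - K1 \<Longrightarrow> E1 u v \<longleftrightarrow> E2 (h u) (h v)"
    "\<And>v v'. v \<in> V1 - K1 \<Longrightarrow> v' \<in> V2 - K2 \<Longrightarrow> keeps g v v' \<Longrightarrow> h v = v'"
    using assms(8) by (auto simp: realizes_def)
  have fK: "f u \<in> K2" if "u \<in> K1" for u using f(1) that by (auto simp: bij_betw_def)
  have hK: "h u \<in> V2 - K2" if "u \<in> V1 - K1" for u using h(1) that unfolding bij_betw_def by blast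
  have "bij_betw k (K1 \<union> (V1 - K1)) (K2 \<union> (V2 - K2))"
  proof (rule bij_betw_combine)
    show "bij_betw k K1 K2" using f(1) by (simp add: k_def cong: bij_betw_cong)
    show "bij_betw k (V1 - K1) (V2 - K2)"
      using h(1) by (subst bij_betw_cong[where g = h]) (auto simp: k_def)
  qed auto
  moreover have "E1 u v \<longleftrightarrow> E2 (k u) (k v)" if "u \<in> V1" "v \<in> V1" for u v
    using that f(2) h(2) fK hK closed_partD[OF assms(1,4)] closed_partD[OF assms(2,5)]
    unfolding k_def by (metis DiffI)
  moreover have "k v = v'" if v: "v \<in> V1" "v' \<in> V2" "keeps g v v'" for v v'
  proof -
    \<comment> \<open>A constraint never crosses between the parts, since \<open>g\<close> maps
      \<open>Phi v\<close> to \<open>Phi v'\<close> and \<open>W K1\<close> onto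
      \<open>W K2\<close>.\<close>
    have "v \<in> K1 \<longleftrightarrow> Phi v \<in> W K1" by simp
    also have "\<dots> \<longleftrightarrow> g (Phi v) \<in> g ` W K1"
      using cycle_isoD(2)[OF assms(3)] v(1) W_mono[OF K(1)] by (simp add: inj_on_image_mem_iff)
    also have "\<dots> \<longleftrightarrow> v' \<in> K2" using v(3) assms(6) by (simp add: keeps_def)
    finally show ?thesis using v f(3) h(3) by (auto simp: k_def)
  qed
  ultimately show ?thesis using K by (auto simp: realizes_def Un_absorb1)
qed

text \<open>The first vertex of a longest path is a leaf: a neighbour off the path would extend it,
  and one at position two or later would close a cycle.\<close>

lemma exists_leaf:
  assumes "acyclic_on V E" "V \<noteq> {}" "\<And>v. v \<in> V \<Longrightarrow> nbrs V E v \<noteq> {}"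
  obtains l w where "leaf V E l w"
proof -
  define path where "path p \<longleftrightarrow> p \<noteq> [] \<and> distinct p \<and> set p \<subseteq> V
    \<and> (\<forall>i. Suc i < length p \<longrightarrow> E (p ! i) (p ! Suc i))" for p
  have fin: "finite V" using acyclic_onD(1)[OF assms(1)] .
  obtain v0 where "v0 \<in> V" using assms(2) by blast
  then have p0: "path [v0]" by (simp add: path_def)
  have bound: "length p \<le> card V" if "path p" for p
    using that fin by (metis card_mono distinct_card path_def)
  obtain p where p: "path p" and max: "\<And>q. path q \<Longrightarrow> length q \<le> length p"
    using ex_has_greatest_nat[of path "[v0]" length "Suc (card V)"] p0 bound by (metis le_imp_less_Suc)
  then obtain a q where pq: "p = a # q" by (cases p) (auto simp: path_def)
  have a: "a \<in> V" using p pq by (auto simp: path_def)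
  have sub: "b = p ! 1" if b: "b \<in> nbrs V E a" for b
  proof -
    have bV: "b \<in> V" "E a b" "E b a" using b a acyclic_onD(2)[OF assms(1)] by (auto simp: nbrs_def)
    have "b \<in> set p"
    proof (rule ccontr)
      assume "b \<notin> set p"
      moreover have "E ((b # p) ! i) ((b # p) ! Suc i)" if "Suc i < length (b # p)" for i
        using that p bV(3) pq by (cases i) (auto simp: path_def)
      ultimately have "path (b # p)"
        using p bV by (simp add: path_def)
      then show False using max by fastforce
    qed
    then obtain i where i: "i < length p" "p ! i = b" by (auto simp: in_set_conv_nth)
    have "i \<noteq> 0" using i(2) pq bV(2) acyclic_onD(3)[OF assms(1) a] by (metis nth_Cons_0)
    moreover have "\<not> i \<ge> 2"
    proof
      assume "i \<ge> 2"
      then have "is_cycle V E (take (Suc i) p)"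
        using i p bV(3) pq set_take_subset[of "Suc i" p]
        unfolding is_cycle_def path_def by (auto simp: last_conv_nth simp del: take_Suc_Cons)
      then show False using assms(1) by (auto simp: acyclic_on_def)
    qed
    ultimately have "i = 1" by simp
    then show ?thesis using i by simp
  qed
  then have "nbrs V E a = {p ! 1}" using assms(3)[OF a] by auto
  then show ?thesis using that a by (simp add: leaf_def)
qed

section \<open>Small cocycles of a forest\<close>

text \<open>A cocycle meets the zero-sum triangle at \<open>v\<close> in an even number of elements.
  Hence cocycles of size two or four live on one or two vertices.\<close>

lemma cocycle_Int_triple:
  assumes "acyclic_on V E" "cocycle V E D" "v \<in> V" "D \<inter> W {v} \<noteq> {}"
  shows "card (D \<inter> W {v}) = 2"
proof -
  have "W {v} = {Phi v, Chi v, Psi v}" by (auto simp: W_def)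
  then have "D \<inter> W {v} = {Phi v, Chi v} \<or> D \<inter> W {v} = {Phi v, Psi v} \<or> D \<inter> W {v} = {Chi v, Psi v}"
    using cocycle_Psi_iff[OF assms(1-3)] assms(4)
    by (cases "Phi v \<in> D"; cases "Chi v \<in> D"; cases "Psi v \<in> D") auto
  then show ?thesis by (elim disjE) simp_all
qed

lemma cocycle_Chi_neighbour:
  assumes "acyclic_on V E" "cocycle V E D" "v \<in> V" "{u \<in> nbrs V E v. Phi u \<in> D} = {a}"
  shows "Chi v \<in> D"
  using cocycle_Chi_iff[OF assms(1-3)] assms(4) by simp

lemma cocycle_Chi_no_neighbour:
  assumes "acyclic_on V E" "cocycle V E D" "v \<in> V" "{u \<in> nbrs V E v. Phi u \<in> D} = {}"
  shows "Chi v \<notin> D"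
  using cocycle_Chi_iff[OF assms(1-3)] assms(4) by simp

text \<open>The cocycle lives on a single vertex \<open>a\<close>. A neighbour of \<open>a\<close>
  would see exactly one \<open>Phi\<close> element and thus contribute its own \<open>Chi\<close>
  element.\<close>

lemma cocycle_card_2:
  assumes "acyclic_on V E" "cocycle V E D" "card D = 2"
  obtains a where "a \<in> V" "nbrs V E a = {}" "D = {Phi a, Psi a}"
proof -
  have "D \<noteq> {}" using assms(3) by auto
  then obtain a where a: "a \<in> V" "Phi a \<in> D" by (rule cocycle_has_Phi[OF assms(1,2)])
  then have "card (D \<inter> W {a}) = 2" by (intro cocycle_Int_triple[OF assms(1,2)]) auto
  moreover have fin: "finite D" using assms(3) by (simp add: card_ge_0_finite)
  ultimately have "D \<inter> W {a} = D" using assms(3) by (intro card_subset_eq) auto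
  then have sub: "D \<subseteq> W {a}" by blast
  have N: "nbrs V E a = {}"
  proof (rule ccontr)
    assume "nbrs V E a \<noteq> {}"
    then obtain b where b: "b \<in> nbrs V E a" by blast
    then have bV: "b \<in> V" using nbrs_subset[of V E a] by auto
    then have "{u \<in> nbrs V E b. Phi u \<in> D} = {a}"
      using b a sub nbrs_sym[OF assms(1) a(1)] by auto
    then have "Chi b \<in> D" using cocycle_Chi_neighbour[OF assms(1,2) bV] by simp
    then show False using b sub nbrs_irrefl[OF assms(1)] by auto
  qed
  then have "Chi a \<notin> D" by (intro cocycle_Chi_no_neighbour[OF assms(1,2) a(1)]) auto
  then have "D = {Phi a, Psi a}"
    using sub a cocycle_Psi_iff[OF assms(1,2) a(1)] by (auto simp: W_def)
  with a(1) N that show ?thesis by blast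
qed

text \<open>The cocycle lives on two vertices and is one row or the sum of two rows. No third vertex
  may be adjacent to an odd number of the vertices naming these rows, and acyclicity leaves only the
  three listed shapes.\<close>

lemma cocycle_card_4:
  assumes "acyclic_on V E" "\<And>v. v \<in> V \<Longrightarrow> nbrs V E v \<noteq> {}" "cocycle V E D" "card D = 4"
  obtains
    (pendant) l w where "leaf V E l w" "D = {Phi l, Psi l, Chi w, Psi w}"
  | (twins) l l' w where "leaf V E l w" "leaf V E l' w" "l \<noteq> l'" "D = {Phi l, Psi l, Phi l', Psi l'}"
  | (edge) a b where "leaf V E a b" "leaf V E b a" "D = {Phi a, Chi a, Phi b, Chi b}"
proof -
  note ac = assms(1) note co = assms(3)
  have fin: "finite D" using assms(4) by (simp add: card_ge_0_finite)
  have "D \<noteq> {}" using assms(4) by auto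
  then obtain a where a: "a \<in> V" "Phi a \<in> D" by (rule cocycle_has_Phi[OF ac co])
  then have ca: "card (D \<inter> W {a}) = 2" by (intro cocycle_Int_triple[OF ac co]) auto
  have cb: "card (D - W {a}) = 2"
    using card_Diff_subset_Int[of D "W {a}"] fin ca assms(4) by simp
  then have "D - W {a} \<noteq> {}" by (metis card.empty zero_neq_numeral)
  then obtain y where y: "y \<in> D" "y \<notin> W {a}" by blast
  then obtain b where b: "b \<in> V" "y \<in> W {b}" using co by (auto simp: cocycle_def W_def)
  have ab: "a \<noteq> b" using y b by auto
  have "card (D \<inter> W {b}) = 2" using y b by (intro cocycle_Int_triple[OF ac co]) auto
  moreover have "D \<inter> W {b} \<subseteq> D - W {a}" using ab by (auto simp: W_def)
  ultimately have "D \<inter> W {b} = D - W {a}" using fin cb by (intro card_subset_eq) auto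
  then have sub: "D \<subseteq> W {a, b}" by (auto simp: W_def)
  have iff: "Psi a \<in> D \<longleftrightarrow> Chi a \<notin> D" "Psi b \<in> D \<longleftrightarrow> (Phi b \<in> D) \<noteq> (Chi b \<in> D)"
    using cocycle_Psi_iff[OF ac co] a b by auto
  have Chi_sub: "v = a \<or> v = b" if "Chi v \<in> D" for v using that sub by auto
  have irr: "v \<notin> nbrs V E v" for v using nbrs_irrefl[OF ac] .
  show thesis
  proof (cases "Phi b \<in> D")
    \<comment> \<open>Here \<open>D\<close> is the row of \<open>a\<close>, so each neighbour of
      \<open>a\<close> has its \<open>Chi\<close> element in \<open>D\<close> and must be
      \<open>b\<close>.\<close>
    case False
    then have X: "Phi v \<in> D \<longleftrightarrow> v = a" for v using False a sub by auto
    have only: "v = b" if v: "v \<in> nbrs V E a" for v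
    proof -
      have vV: "v \<in> V" using v nbrs_subset[of V E a] by auto
      then have "{u \<in> nbrs V E v. Phi u \<in> D} = {a}"
        using v nbrs_sym[OF ac a(1)] by (auto simp: X)
      then have "Chi v \<in> D" using cocycle_Chi_neighbour[OF ac co vV] by simp
      then show ?thesis using Chi_sub[of v] v irr by auto
    qed
    have "nbrs V E a = {b}" using only assms(2)[OF a(1)] by blast
    then have lab: "leaf V E a b" using a(1) by (simp add: leaf_def)
    have "{u \<in> nbrs V E a. Phi u \<in> D} = {}" using irr[of a] by (auto simp: X)
    then have "Chi a \<notin> D" by (rule cocycle_Chi_no_neighbour[OF ac co a(1)])
    moreover have "Chi b \<in> D" using y b False iff by (auto simp: W_def)
    ultimately have "D = {Phi a, Psi a, Chi b, Psi b}"
      using sub a iff False by (auto simp: W_def)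
    with lab show thesis by (rule pendant)
  next
    case True
    then have X: "Phi v \<in> D \<longleftrightarrow> v = a \<or> v = b" for v using a sub by auto
    \<comment> \<open>A third vertex adjacent to just one of \<open>a\<close> and \<open>b\<close>
      would have its \<open>Chi\<close> element in \<open>D\<close>.\<close>
    have same: "v \<in> nbrs V E a \<longleftrightarrow> v \<in> nbrs V E b" if v: "v \<in> V" "v \<noteq> a" "v \<noteq> b" for v
    proof (rule ccontr)
      assume "\<not> ?thesis"
      then have "\<exists>z. {u \<in> nbrs V E v. Phi u \<in> D} = {z}"
        using nbrs_sym[OF ac v(1) a(1)] nbrs_sym[OF ac v(1) b(1)]
        by (cases "v \<in> nbrs V E a") (auto simp: X)
      then show False using cocycle_Chi_neighbour[OF ac co v(1)] Chi_sub v by blast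
    qed
    show thesis
    proof (cases "\<exists>c. c \<in> nbrs V E a \<and> c \<noteq> b")
      \<comment> \<open>A common neighbour \<open>c\<close> excludes the edge \<open>ab\<close>, as
        there are no triangles, and any further common neighbour, as there are no squares.\<close>
      case True
      then obtain c where c: "c \<in> nbrs V E a" "c \<noteq> b" by blast
      have cV: "c \<in> V" "c \<noteq> a" using c irr nbrs_subset[of V E a] by auto
      have cb: "c \<in> nbrs V E b" using same c cV by blast
      have E: "E a c" "E c b" "E b c"
        using c cb a b cV acyclic_onD(2)[OF ac] by (auto simp: nbrs_def)
      have nab: "b \<notin> nbrs V E a"
        using acyclic_on_no_triangle[OF ac a(1) cV(1) b(1) E(1,2)] a b acyclic_onD(2)[OF ac]
        by (auto simp: nbrs_def)
      then have nba: "a \<notin> nbrs V E b" using nbrs_sym[OF ac a(1) b(1)] by simp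
      have only: "d = c" if d: "d \<in> nbrs V E a" for d
      proof -
        have dV: "d \<in> V" "d \<noteq> a" "d \<noteq> b" using d nab irr nbrs_subset[of V E a] by auto
        then have "d \<in> nbrs V E b" using same d by blast
        then have "E b d" "E d a" using d dV a b acyclic_onD(2)[OF ac] by (auto simp: nbrs_def)
        then show ?thesis using acyclic_on_no_square[OF ac a(1) cV(1) b(1) dV(1) E(1,2) _ _ ab] by simp
      qed
      have "nbrs V E a = {c}" using only c(1) by blast
      then have la: "leaf V E a c" using a by (simp add: leaf_def)
      have only': "d = c" if d: "d \<in> nbrs V E b" for d
        using only[of d] same[of d] d irr nba nbrs_subset[of V E b] by (metis subsetD)
      have "nbrs V E b = {c}" using only' cb by blast
      then have lb: "leaf V E b c" using b by (simp add: leaf_def)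
      have "{u \<in> nbrs V E a. Phi u \<in> D} = {}" "{u \<in> nbrs V E b. Phi u \<in> D} = {}"
        using irr[of a] irr[of b] nab nba by (auto simp: X)
      then have "Chi a \<notin> D" "Chi b \<notin> D"
        using cocycle_Chi_no_neighbour[OF ac co] a b by auto
      then have "D = {Phi a, Psi a, Phi b, Psi b}"
        using sub a iff \<open>Phi b \<in> D\<close> by (auto simp: W_def)
      with la lb ab show thesis by (rule twins)
    next
      \<comment> \<open>Now \<open>b\<close> is the only possible neighbour of \<open>a\<close>, so
        \<open>a\<close> and \<open>b\<close> form a component.\<close>
      case False
      then have "nbrs V E a = {b}" using assms(2)[OF a(1)] by blast
      then have la: "leaf V E a b" using a(1) by (simp add: leaf_def)
      have only: "c = a" if c: "c \<in> nbrs V E b" for c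
        using False same[of c] c irr nbrs_subset[of V E b] by (metis subsetD)
      have "nbrs V E b = {a}" using only assms(2)[OF b(1)] by blast
      then have lb: "leaf V E b a" using b(1) by (simp add: leaf_def)
      have "{u \<in> nbrs V E a. Phi u \<in> D} = {b}" "{u \<in> nbrs V E b. Phi u \<in> D} = {a}"
        using la lb by (auto simp: X leaf_def)
      then have "Chi a \<in> D" "Chi b \<in> D"
        using cocycle_Chi_neighbour[OF ac co] a b by auto
      then have "D = {Phi a, Chi a, Phi b, Chi b}"
        using sub a iff \<open>Phi b \<in> D\<close> by (auto simp: W_def)
      with la lb show thesis by (rule edge)
    qed
  qed
qed

text \<open>Every component has at least three vertices. Smaller components are matched and removed
  separately.\<close>

definition proper_forest :: "'a set \<Rightarrow> ('a \<Rightarrow> 'a \<Rightarrow> bool) \<Rightarrow> bool" where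
  "proper_forest V E \<longleftrightarrow> acyclic_on V E \<and> (\<forall>v\<in>V. nbrs V E v \<noteq> {})
     \<and> (\<forall>l w. leaf V E l w \<longrightarrow> \<not> leaf V E w l)"

lemma proper_forestD:
  assumes "proper_forest V E"
  shows "acyclic_on V E" "\<And>v. v \<in> V \<Longrightarrow> nbrs V E v \<noteq> {}"
    "\<And>l w. leaf V E l w \<Longrightarrow> \<not> leaf V E w l"
  using assms by (auto simp: proper_forest_def)

lemma leaf_second_neighbour:
  assumes "proper_forest V E" "leaf V E l w"
  obtains c where "c \<in> nbrs V E w" "c \<noteq> l"
proof -
  note L = leafD[OF proper_forestD(1)[OF assms(1)] assms(2)]
  have "nbrs V E w \<noteq> {l}" using proper_forestD(3)[OF assms] L(2) by (simp add: leaf_def)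
  then show ?thesis using L(4) that by blast
qed

text \<open>Equal columns arise from \<open>Phi u\<close> and \<open>Chi\<close> of a leaf at
  \<open>u\<close>, or from \<open>Chi\<close> of two leaves at \<open>u\<close>. Any other
  coincidence would force a loop, a short cycle, an isolated vertex or an edge component.\<close>

lemma parallel_cases:
  assumes "proper_forest V E" "x \<in> W V" "y \<in> W V" "x \<noteq> y" "supp V E x = supp V E y"
  obtains m u where "leaf V E m u" "supp V E x = {u}"
proof -
  note P = proper_forestD[OF assms(1)]
  note irr = nbrs_irrefl[OF P(1)] and sym = nbrs_sym[OF P(1)]
  \<comment> \<open>The auxiliary facts go through the kinds of the two elements: \<open>PC\<close>
    is \<open>Phi\<close> with \<open>Chi\<close>, \<open>CC\<close> is two \<open>Chi\<close>,
    \<open>PP\<close> is \<open>Phi\<close> with \<open>Psi\<close>, \<open>CP\<close> is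
    \<open>Chi\<close> with \<open>Psi\<close>, and \<open>PsPs\<close> is two
    \<open>Psi\<close>.\<close>
  have PC: "\<exists>m u. leaf V E m u \<and> supp V E x = {u}"
    if "u \<in> V" "v \<in> V" "supp V E x = {u}" "nbrs V E v = {u}" for u v
    using that by (auto simp: leaf_def)
  have CC: "\<exists>m u. leaf V E m u \<and> supp V E x = {u}"
    if uv: "u \<in> V" "v \<in> V" "u \<noteq> v" "supp V E x = nbrs V E u" "nbrs V E u = nbrs V E v" for u v
  proof -
    obtain c where c: "c \<in> nbrs V E u" using P(2)[OF uv(1)] by blast
    have "d = c" if d: "d \<in> nbrs V E u" for d
    proof -
      have "c \<in> V" "d \<in> V" "E u c" "E c v" "E v d" "E d u"
        using c d uv acyclic_onD(2)[OF P(1)] by (auto simp: nbrs_def)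
      then show ?thesis using acyclic_on_no_square[OF P(1) uv(1) _ uv(2)] uv(3) by metis
    qed
    then have "nbrs V E u = {c}" using c by blast
    then show ?thesis using uv by (auto simp: leaf_def)
  qed
  have PP: False if "u \<in> V" "v \<in> V" "{u} = insert v (nbrs V E v)" for u v
  proof -
    have "nbrs V E v \<subseteq> {v}" using that(3) by blast
    then show False using P(2)[OF that(2)] irr[of v] by blast
  qed
  have CP: False if "u \<in> V" "v \<in> V" "nbrs V E u = insert v (nbrs V E v)" for u v
    using that sym[of u v] irr[of u] by auto
  have PsPs: False
    if uv: "u \<in> V" "v \<in> V" "u \<noteq> v" "insert u (nbrs V E u) = insert v (nbrs V E v)" for u v
  proof -
    have e: "v \<in> nbrs V E u" "u \<in> nbrs V E v" using uv by auto
    have "c = v" if c: "c \<in> nbrs V E u" for c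
    proof (rule ccontr)
      assume "c \<noteq> v"
      then have "c \<in> nbrs V E v" using c uv irr by auto
      then show False
        using acyclic_on_no_triangle[OF P(1) uv(1) _ uv(2), of c] c e uv acyclic_onD(2)[OF P(1)]
        by (auto simp: nbrs_def)
    qed
    then have N: "nbrs V E u = {v}" using e(1) by blast
    then have "nbrs V E v = {u}" using uv e irr[of v] by auto
    with N show False using P(3)[of u v] uv by (simp add: leaf_def)
  qed
  have "\<exists>m u. leaf V E m u \<and> supp V E x = {u}"
    using assms(2)
  proof (cases rule: W_cases)
    case x: (1 u)
    show ?thesis using assms(3)
    proof (cases rule: W_cases)
      case (1 v) then show ?thesis using x assms(4,5) by (simp add: supp_Phi)
    next
      case (2 v) show ?thesis by (rule PC[of u v]) (use x 2 assms(5) in \<open>auto simp: supp_Phi supp_Chi\<close>)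
    next
      case (3 v) have False by (rule PP[of u v]) (use x 3 assms(5) in \<open>auto simp: supp_Phi supp_Psi[OF P(1)]\<close>) then show ?thesis ..
    qed
  next
    case x: (2 u)
    show ?thesis using assms(3)
    proof (cases rule: W_cases)
      case (1 v) show ?thesis by (rule PC[of v u]) (use x 1 assms(5) in \<open>auto simp: supp_Phi supp_Chi\<close>)
    next
      case (2 v) show ?thesis by (rule CC[of u v]) (use x 2 assms(4,5) in \<open>auto simp: supp_Chi\<close>)
    next
      case (3 v) have False by (rule CP[of u v]) (use x 3 assms(5) in \<open>auto simp: supp_Chi supp_Psi[OF P(1)]\<close>) then show ?thesis ..
    qed
  next
    case x: (3 u)
    show ?thesis using assms(3)
    proof (cases rule: W_cases)
      case (1 v) have False by (rule PP[of v u]) (use x 1 assms(5) in \<open>auto simp: supp_Phi supp_Psi[OF P(1)]\<close>) then show ?thesis ..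
    next
      case (2 v) have False by (rule CP[of v u]) (use x 2 assms(5) in \<open>auto simp: supp_Chi supp_Psi[OF P(1)]\<close>) then show ?thesis ..
    next
      case (3 v) have False by (rule PsPs[of u v]) (use x 3 assms(4,5) in \<open>auto simp: supp_Psi[OF P(1)]\<close>) then show ?thesis ..
    qed
  qed
  then show ?thesis using that by blast
qed

text \<open>Describes the parallel class of \<open>Phi w\<close>. A \<open>Psi\<close> element could
  belong to it only if \<open>w\<close> were isolated.\<close>

lemma supp_eq_singleton:
  assumes "acyclic_on V E" "x \<in> W V" "supp V E x = {w}" "nbrs V E w \<noteq> {}"
  shows "x = Phi w \<or> (\<exists>m. leaf V E m w \<and> x = Chi m)"
  using assms(2)
proof (cases rule: W_cases)
  case (1 v)
  then show ?thesis using assms(3) by (simp add: supp_Phi)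
next
  case (2 v)
  then show ?thesis using assms(3) by (simp add: supp_Chi leaf_def)
next
  case (3 v)
  then have "v = w" "nbrs V E v \<subseteq> {w}" using assms(1,3) by (auto simp: supp_Psi)
  then show ?thesis using assms(4) nbrs_irrefl[OF assms(1), of w] by auto
qed

text \<open>This set is row \<open>l\<close> of the matrix.\<close>

lemma pendant_cocycle:
  assumes "acyclic_on V E" "leaf V E l w"
  shows "cocycle V E {Phi l, Psi l, Chi w, Psi w}" "card {Phi l, Psi l, Chi w, Psi w} = 4"
proof -
  note L = leafD[OF assms]
  have "l \<in> nbrs V E v \<longleftrightarrow> v = w" if "v \<in> V" for v
    using nbrs_sym[OF assms(1) L(1) that] L(3) by auto
  then have "{x \<in> W V. l \<in> supp V E x} = {Phi l, Psi l, Chi w, Psi w}"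
    using L by (auto elim!: W_cases simp: supp_Phi supp_Chi supp_Psi[OF assms(1)])
  then show "cocycle V E {Phi l, Psi l, Chi w, Psi w}"
    using row_cocycle[OF assms(1) L(1)] by simp
qed (use leafD(5)[OF assms] in simp)

text \<open>The elements of the cocycle of a leaf add up to zero, so they split into two pairs with equal
  sums in three ways. The alternative in which \<^term>\<open>w\<close> has degree two is the exceptional one.\<close>

lemma pendant_split:
  assumes "proper_forest V E" "leaf V E l w"
    "x \<in> {Phi l, Psi l, Chi w, Psi w}" "y \<in> {Phi l, Psi l, Chi w, Psi w}" "x \<noteq> y"
    "sym_diff (supp V E x) (supp V E y) = {u}"
  shows "u = w \<and> ({x, y} = {Phi l, Psi l} \<or> {x, y} = {Chi w, Psi w})
    \<or> nbrs V E w = {l, u} \<and> ({x, y} = {Phi l, Chi w} \<or> {x, y} = {Psi l, Psi w})"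
proof -
  note ac = proper_forestD(1)[OF assms(1)]
  note L = leafD[OF ac assms(2)]
  obtain c where c: "c \<in> nbrs V E w" "c \<noteq> l" using leaf_second_neighbour[OF assms(1,2)] .
  have w: "w \<notin> nbrs V E w" using nbrs_irrefl[OF ac] .
  have S: "supp V E (Phi l) = {l}" "supp V E (Psi l) = {l, w}" "supp V E (Chi w) = nbrs V E w"
    "supp V E (Psi w) = insert w (nbrs V E w)"
    using L by (auto simp: supp_Phi supp_Chi supp_Psi[OF ac])
  \<comment> \<open>Sums for the two splits other than \<open>Phi l\<close>, \<open>Psi l\<close>
    against \<open>Chi w\<close>, \<open>Psi w\<close>. Both pairs of a split have the same
    sum.\<close>
  have e: "sym_diff {l} (nbrs V E w) = nbrs V E w - {l}"
    "sym_diff {l, w} (insert w (nbrs V E w)) = nbrs V E w - {l}"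
    "sym_diff {l} (insert w (nbrs V E w)) = insert w (nbrs V E w - {l})"
    "sym_diff {l, w} (nbrs V E w) = insert w (nbrs V E w - {l})"
    using L(4,5) w by auto
  have Q1: "nbrs V E w = {l, u}" if "nbrs V E w - {l} = {u}"
    using that L(4) insert_Diff[of l "nbrs V E w"] by simp
  \<comment> \<open>The split pairing \<open>Phi l\<close> with \<open>Psi w\<close> never yields a
    single vertex: its sum contains \<open>w\<close> and the second neighbour
    \<open>c\<close>.\<close>
  have Q2: False if *: "insert w (nbrs V E w - {l}) = {u}"
  proof -
    have "w \<in> {u}" "c \<in> {u}" using c unfolding *[symmetric] by auto
    then show False using c(1) w by auto
  qed
  have P1: "nbrs V E w = {l, u}" if "sym_diff {l} (nbrs V E w) = {u}"
    using that unfolding e by (rule Q1)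
  have P2: "nbrs V E w = {l, u}" if "sym_diff {l, w} (insert w (nbrs V E w)) = {u}"
    using that unfolding e by (rule Q1)
  have P3: False if "sym_diff {l} (insert w (nbrs V E w)) = {u}"
    using that unfolding e by (rule Q2)
  have P4: False if "sym_diff {l, w} (nbrs V E w) = {u}"
    using that unfolding e by (rule Q2)
  have P5: "u = w" if "sym_diff {l} {l, w} = {u}" using that L(5) by auto
  have P6: "u = w" if "sym_diff (nbrs V E w) (insert w (nbrs V E w)) = {u}"
  proof -
    have "sym_diff (nbrs V E w) (insert w (nbrs V E w)) = {w}" using w by auto
    then show ?thesis using that by simp
  qed
  have comm: "sym_diff A B = sym_diff B A" for A B :: "'a set" by auto
  consider "{x, y} = {Phi l, Psi l}" | "{x, y} = {Chi w, Psi w}" | "{x, y} = {Phi l, Chi w}"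
    | "{x, y} = {Psi l, Psi w}" | "{x, y} = {Phi l, Psi w}" | "{x, y} = {Psi l, Chi w}"
    using assms(3-5) by auto
  then show ?thesis
  proof cases
    case 1
    then have "sym_diff {l} {l, w} = {u}" using assms(6) S comm by (metis doubleton_eq_iff)
    then show ?thesis using P5 1 by simp
  next
    case 2
    then have "sym_diff (nbrs V E w) (insert w (nbrs V E w)) = {u}"
      using assms(6) S comm by (metis doubleton_eq_iff)
    then show ?thesis using P6 2 by simp
  next
    case 3
    then have "sym_diff {l} (nbrs V E w) = {u}" using assms(6) S comm by (metis doubleton_eq_iff)
    then show ?thesis using P1 3 by simp
  next
    case 4
    then have "sym_diff {l, w} (insert w (nbrs V E w)) = {u}"
      using assms(6) S comm by (metis doubleton_eq_iff)
    then show ?thesis using P2 4 by simp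
  next
    case 5
    then have "sym_diff {l} (insert w (nbrs V E w)) = {u}"
      using assms(6) S comm by (metis doubleton_eq_iff)
    then show ?thesis using P3 by simp
  next
    case 6
    then have "sym_diff {l, w} (nbrs V E w) = {u}" using assms(6) S comm by (metis doubleton_eq_iff)
    then show ?thesis using P4 by simp
  qed
qed

text \<open>The sum of a pair mixing the two leaves contains both \<open>l\<close> and
  \<open>l'\<close>, so a one-vertex sum forces both elements to belong to the same leaf.\<close>

lemma twins_split:
  assumes "acyclic_on V E" "leaf V E l w" "leaf V E l' w" "l \<noteq> l'"
    "x \<in> {Phi l, Psi l, Phi l', Psi l'}" "y \<in> {Phi l, Psi l, Phi l', Psi l'}" "x \<noteq> y"
    "sym_diff (supp V E x) (supp V E y) = {u}"
  shows "u = w \<and> ({x, y} = {Phi l, Psi l} \<or> {x, y} = {Phi l', Psi l'})"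
proof -
  note L = leafD[OF assms(1,2)] leafD[OF assms(1,3)]
  have S: "supp V E (Phi l) = {l}" "supp V E (Psi l) = {l, w}"
    "supp V E (Phi l') = {l'}" "supp V E (Psi l') = {l', w}"
    using L by (auto simp: supp_Phi supp_Psi[OF assms(1)])
  have P: "sym_diff {l} {l'} = {l, l'}" "sym_diff {l} {l', w} = {l, l', w}"
    "sym_diff {l, w} {l'} = {l, l', w}" "sym_diff {l, w} {l', w} = {l, l'}"
    "sym_diff {l} {l, w} = {w}" "sym_diff {l'} {l', w} = {w}"
    using L assms(4) by auto
  have comm: "sym_diff A B = sym_diff B A" for A B :: "'a set" by auto
  consider "{x, y} = {Phi l, Psi l}" | "{x, y} = {Phi l', Psi l'}" | "{x, y} = {Phi l, Phi l'}"
    | "{x, y} = {Phi l, Psi l'}" | "{x, y} = {Psi l, Phi l'}" | "{x, y} = {Psi l, Psi l'}"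
    using assms(5-7) by auto
  then show ?thesis
  proof cases
    case 1
    then have "sym_diff {l} {l, w} = {u}" using assms(6,8) S comm by (metis doubleton_eq_iff)
    then show ?thesis using 1 P by simp
  next
    case 2
    then have "sym_diff {l'} {l', w} = {u}" using assms(6,8) S comm by (metis doubleton_eq_iff)
    then show ?thesis using 2 P by simp
  next
    case 3
    then have "sym_diff {l} {l'} = {u}" using assms(6,8) S comm by (metis doubleton_eq_iff)
    then show ?thesis using 3 P assms(4) by auto
  next
    case 4
    then have "sym_diff {l} {l', w} = {u}" using assms(6,8) S comm by (metis doubleton_eq_iff)
    then show ?thesis using 4 P assms(4) by auto
  next
    case 5
    then have "sym_diff {l, w} {l'} = {u}" using assms(6,8) S comm by (metis doubleton_eq_iff)
    then show ?thesis using 5 P assms(4) by auto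
  next
    case 6
    then have "sym_diff {l, w} {l', w} = {u}" using assms(6,8) S comm by (metis doubleton_eq_iff)
    then show ?thesis using 6 P assms(4) by auto
  qed
qed

text \<open>Since \<open>w\<close> is not a leaf and there are no edge components, the
  classification of four-element cocycles has only the row of \<open>l\<close> touching both
  \<open>l\<close> and \<open>w\<close>.\<close>

lemma mixed_pair_cocycle:
  assumes "proper_forest V E" "cocycle V E D" "card D = 4" "leaf V E l w"
    "{Phi l, Chi w} \<subseteq> D \<or> {Psi l, Psi w} \<subseteq> D"
  shows "D = {Phi l, Psi l, Chi w, Psi w}"
proof -
  note P = proper_forestD[OF assms(1)]
  note L = leafD[OF P(1) assms(4)]
  have no: "\<not> leaf V E w c" for c
  proof
    assume w: "leaf V E w c"
    then have "c = l" using L by (auto simp: leaf_def)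
    then show False using w P(3)[OF assms(4)] by simp
  qed
  show ?thesis
  proof (rule cocycle_card_4[OF P(1,2) assms(2,3)])
    fix l1 w1 assume *: "leaf V E l1 w1" "D = {Phi l1, Psi l1, Chi w1, Psi w1}"
    then have "l1 \<noteq> w" using no by auto
    then show ?thesis using assms(5) * L by auto
  next
    fix l1 l2 w1 assume *: "leaf V E l1 w1" "leaf V E l2 w1" "D = {Phi l1, Psi l1, Phi l2, Psi l2}"
    then have "l1 \<noteq> w" "l2 \<noteq> w" using no by auto
    then show ?thesis using assms(5) * by auto
  next
    fix a b assume "leaf V E a b" "leaf V E b a"
    then show ?thesis using P(3) by blast
  qed
qed

section \<open>Isolated vertices and single edges\<close>

text \<open>Lets \<open>g\<close> be corrected by an automorphism \<open>\<sigma>\<close> of the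
  second matroid, provided no constraint imposed by \<open>keeps\<close> gets lost.\<close>

lemma realizes_comp:
  assumes "\<And>v v'. v \<in> V1 \<Longrightarrow> v' \<in> V2 \<Longrightarrow> keeps g v v' \<Longrightarrow> keeps (\<sigma> \<circ> g) v v'"
    "realizes V1 E1 V2 E2 (\<sigma> \<circ> g) f"
  shows "realizes V1 E1 V2 E2 g f"
  using assms unfolding realizes_def by blast

lemma keeps_comp:
  assumes "keeps g v v'" "\<sigma> (Phi v') = Phi v'" "{\<sigma> (Chi v'), \<sigma> (Psi v')} = {Chi v', Psi v'}"
  shows "keeps (\<sigma> \<circ> g) v v'"
proof -
  have "{\<sigma> (g (Chi v)), \<sigma> (g (Psi v))} = \<sigma> ` {g (Chi v), g (Psi v)}" by simp
  also have "\<dots> = {\<sigma> (Chi v'), \<sigma> (Psi v')}" using assms(1) by (simp add: keeps_def)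
  finally show ?thesis using assms by (simp add: keeps_def)
qed

lemma keepsD:
  assumes "keeps g v v'"
  shows "g (Phi v) = Phi v'" "{g (Chi v), g (Psi v)} = {Chi v', Psi v'}"
    "Chi v' = g (Chi v) \<or> Chi v' = g (Psi v)" "Psi v' = g (Chi v) \<or> Psi v' = g (Psi v)"
    "g (Chi v) = Chi v' \<or> g (Chi v) = Psi v'" "g (Psi v) = Chi v' \<or> g (Psi v) = Psi v'"
  using assms by (auto simp: keeps_def doubleton_eq_iff)

lemma supp_eq_empty:
  assumes "acyclic_on V E" "x \<in> W V" "supp V E x = {}"
  obtains v where "v \<in> V" "x = Chi v" "nbrs V E v = {}"
  using assms(2)
proof (cases rule: W_cases)
  case (2 v)
  then show ?thesis using assms(3) that by (simp add: supp_Chi)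
qed (use assms in \<open>auto simp: supp_Phi supp_Psi\<close>)

lemma cycle_iso_isolated:
  assumes "acyclic_on V1 E1" "acyclic_on V2 E2" "cycle_iso V1 E1 V2 E2 g"
    "v \<in> V1" "nbrs V1 E1 v = {}"
  obtains v' where "v' \<in> V2" "nbrs V2 E2 v' = {}" "g (Chi v) = Chi v'"
proof -
  have "supp V2 E2 (g (Chi v)) = {}"
    using cycle_iso_supp_empty[OF assms(3), of "Chi v"] assms(4,5) by (simp add: supp_Chi)
  moreover have "g (Chi v) \<in> W V2" using cycle_isoD(4)[OF assms(3)] assms(4) by simp
  ultimately show ?thesis using supp_eq_empty[OF assms(2)] that by metis
qed

lemma W_single: "W {v} = {Phi v, Chi v, Psi v}"
  by (auto simp: W_def)

text \<open>The two-element cocycle of \<open>v\<close> fixes the target \<open>v'\<close>. The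
  matroid loop \<open>Chi v\<close> may go to the loop \<open>Chi v''\<close> of another isolated
  vertex; exchanging the two loops repairs this, and \<open>v\<close> is removed as a
  component.\<close>

lemma realize_isolated:
  assumes ac: "acyclic_on V1 E1" "acyclic_on V2 E2" and g: "cycle_iso V1 E1 V2 E2 g"
    and v: "v \<in> V1" "nbrs V1 E1 v = {}"
    and IH: "\<And>h v'. v' \<in> V2 \<Longrightarrow> cycle_iso (V1 - {v}) E1 (V2 - {v'}) E2 h
      \<Longrightarrow> \<exists>f. realizes (V1 - {v}) E1 (V2 - {v'}) E2 h f"
  shows "\<exists>f. realizes V1 E1 V2 E2 g f"
proof -
  note eq = cycle_iso_eq_iff[OF g]
  have "v \<notin> nbrs V1 E1 u" if "u \<in> V1" for u
    using nbrs_sym[OF ac(1) v(1) that] v(2) by simp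
  then have "{x \<in> W V1. v \<in> supp V1 E1 x} = {Phi v, Psi v}"
    using v by (auto elim!: W_cases simp: supp_Phi supp_Chi supp_Psi[OF ac(1)])
  then have "cocycle V1 E1 {Phi v, Psi v}" using row_cocycle[OF ac(1) v(1)] by simp
  then have "cocycle V2 E2 (g ` {Phi v, Psi v})" by (rule cycle_iso_cocycle[OF g])
  moreover have "card (g ` {Phi v, Psi v}) = 2" using eq[of "Phi v" "Psi v"] v by simp
  ultimately obtain v' where v': "v' \<in> V2" "nbrs V2 E2 v' = {}" "g ` {Phi v, Psi v} = {Phi v', Psi v'}"
    by (rule cocycle_card_2[OF ac(2)])
  obtain v'' where v'': "v'' \<in> V2" "nbrs V2 E2 v'' = {}" "g (Chi v) = Chi v''"
    using cycle_iso_isolated[OF ac g v] .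
  define \<sigma> where "\<sigma> = (swap (Chi v'') (Chi v') :: 'b welem \<Rightarrow> _)"
  define h where "h = \<sigma> \<circ> g"
  have "cycle_iso V2 E2 V2 E2 \<sigma>"
    unfolding \<sigma>_def by (rule swap_cycle_iso) (use v' v'' in \<open>auto simp: supp_Chi\<close>)
  then have h: "cycle_iso V1 E1 V2 E2 h" unfolding h_def by (rule cycle_iso_comp[OF g])
  \<comment> \<open>If \<open>v'\<close> and \<open>v''\<close> differ, no constraint ends at
    either: it would have to start at \<open>v\<close>, whose \<open>Phi\<close> and
    \<open>Chi\<close> elements go to different vertices.\<close>
  have keep: "keeps h u u'" if u: "u \<in> V1" "u' \<in> V2" "keeps g u u'" for u u'
  proof (cases "v' = v''")
    case True
    then have "\<sigma> = id" by (auto simp: \<sigma>_def swap_def fun_eq_iff)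
    then show ?thesis using u by (simp add: h_def)
  next
    case False
    note K = keepsD[OF u(3)]
    have "u' \<noteq> v''"
    proof
      assume "u' = v''"
      then have "u = v" using K(3) v''(3) eq[of "Chi v" "Chi u"] eq[of "Chi v" "Psi u"] u v by auto
      then have "Phi v'' \<in> g ` {Phi v, Psi v}" using K(1) \<open>u' = v''\<close> by auto
      then show False unfolding v'(3) using False by simp
    qed
    moreover have "u' \<noteq> v'"
    proof
      assume *: "u' = v'"
      then have "g (Phi u) \<in> g ` {Phi v, Psi v}" unfolding v'(3) using K(1) by simp
      then have "u = v" using eq[of "Phi u" "Phi v"] eq[of "Phi u" "Psi v"] u v by auto
      then show False using K(5) v''(3) * False by auto
    qed
    ultimately show ?thesis unfolding h_def using u(3) by (intro keeps_comp) (auto simp: \<sigma>_def swap_def)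
  qed
  have "h ` {Phi v, Psi v} = \<sigma> ` {Phi v', Psi v'}" unfolding h_def image_comp[symmetric] v'(3) ..
  then have "h ` {Phi v, Psi v} = {Phi v', Psi v'}" by (simp add: \<sigma>_def swap_def)
  moreover have "h (Chi v) = Chi v'" by (simp add: h_def \<sigma>_def swap_def v'')
  moreover have "h ` W {v} = insert (h (Chi v)) (h ` {Phi v, Psi v})" by (auto simp: W_single)
  ultimately have hW: "h ` W {v} = W {v'}" by (simp only: W_single insert_commute)
  have cl: "closed_part V1 E1 {v}" "closed_part V2 E2 {v'}"
    using v v' by (auto simp: closed_part_def)
  obtain f where "realizes (V1 - {v}) E1 (V2 - {v'}) E2 h f"
    using IH[OF v'(1)] cycle_iso_remove_part[OF h ac cl hW] by blast
  moreover have "realizes {v} E1 {v'} E2 h (\<lambda>_. v')"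
    using acyclic_onD(3)[OF ac(1) v(1)] acyclic_onD(3)[OF ac(2) v'(1)]
    by (auto simp: realizes_def)
  ultimately obtain k where "realizes V1 E1 V2 E2 h k"
    using realizes_combine[OF ac h cl hW] by blast
  then have "realizes V1 E1 V2 E2 g k"
    unfolding h_def using keep[unfolded h_def] by (rule realizes_comp[rotated])
  then show ?thesis by blast
qed

text \<open>Parallel partners distinguish edge components: in the row of a leaf \<open>l\<close> the
  partner of \<open>Phi l\<close> must be \<open>Chi w\<close>, which makes \<open>w\<close> a leaf
  too, and in the cocycle of twins \<open>Phi l\<close> has no partner.\<close>

lemma edge_detect:
  assumes "acyclic_on V E" "\<And>v. v \<in> V \<Longrightarrow> nbrs V E v \<noteq> {}" "cocycle V E D" "card D = 4"
    "\<And>x. x \<in> D \<Longrightarrow> \<exists>y\<in>D. y \<noteq> x \<and> supp V E y = supp V E x"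
  obtains a b where "leaf V E a b" "leaf V E b a" "D \<subseteq> W {a, b}"
proof (rule cocycle_card_4[OF assms(1-4)])
  fix l w assume *: "leaf V E l w" "D = {Phi l, Psi l, Chi w, Psi w}"
  note L = leafD[OF assms(1) *(1)]
  have "supp V E (Chi w) = {l}"
    using assms(5)[of "Phi l"] * L by (auto simp: supp_Phi supp_Psi[OF assms(1)])
  then have "leaf V E w l" using L(2) by (simp add: leaf_def supp_Chi)
  then show thesis using that * by auto
next
  fix l l' w assume *: "leaf V E l w" "leaf V E l' w" "l \<noteq> l'" "D = {Phi l, Psi l, Phi l', Psi l'}"
  note L = leafD[OF assms(1) *(1)] leafD[OF assms(1) *(2)]
  have False
    using assms(5)[of "Phi l"] * L by (auto simp: supp_Phi supp_Psi[OF assms(1)])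
  then show thesis ..
next
  fix a b assume "leaf V E a b" "leaf V E b a" "D = {Phi a, Chi a, Phi b, Chi b}"
  then show thesis using that by auto
qed

text \<open>The rows of \<open>a\<close> and \<open>b\<close> together cover
  \<open>W {a, b}\<close>. Each is sent into an edge component, and it is the same one because
  \<open>Psi a\<close> lies in both rows.\<close>

lemma cycle_iso_edge:
  assumes ac: "acyclic_on V1 E1" "acyclic_on V2 E2" and g: "cycle_iso V1 E1 V2 E2 g"
    and ni: "\<And>v. v \<in> V2 \<Longrightarrow> nbrs V2 E2 v \<noteq> {}"
    and ab: "leaf V1 E1 a b" "leaf V1 E1 b a"
  obtains a' b' where "leaf V2 E2 a' b'" "leaf V2 E2 b' a'" "g ` W {a, b} = W {a', b'}"
proof -
  have row: "\<exists>c d. leaf V2 E2 c d \<and> leaf V2 E2 d c \<and> g ` {Phi a, Psi a, Chi b, Psi b} \<subseteq> W {c, d}"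
    if ab: "leaf V1 E1 a b" "leaf V1 E1 b a" for a b
  proof -
    note L = leafD[OF ac(1) ab(1)] leafD[OF ac(1) ab(2)]
    let ?D = "{Phi a, Psi a, Chi b, Psi b}"
    have D: "?D \<subseteq> W V1" using L by simp
    note pc = pendant_cocycle[OF ac(1) ab(1)]
    have c: "cocycle V2 E2 (g ` ?D)" using cycle_iso_cocycle[OF g pc(1)] .
    have "card (g ` ?D) = card ?D"
      using cycle_isoD(2)[OF g] D by (meson card_image inj_on_subset)
    then have card: "card (g ` ?D) = 4" using pc(2) by simp
    have "supp V1 E1 (Phi a) = supp V1 E1 (Chi b)" "supp V1 E1 (Psi a) = supp V1 E1 (Psi b)"
      using L by (auto simp: supp_Phi supp_Chi supp_Psi[OF ac(1)])
    then have s: "supp V2 E2 (g (Phi a)) = supp V2 E2 (g (Chi b))"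
      "supp V2 E2 (g (Psi a)) = supp V2 E2 (g (Psi b))"
      using cycle_iso_supp_eq[OF g] L by auto
    have n: "g (Phi a) \<noteq> g (Chi b)" "g (Psi a) \<noteq> g (Psi b)"
      using cycle_iso_eq_iff[OF g] L by auto
    have "\<forall>x\<in>?D. \<exists>y\<in>?D. g y \<noteq> g x \<and> supp V2 E2 (g y) = supp V2 E2 (g x)"
      by (simp add: s n n[symmetric])
    then have "\<forall>x\<in>g ` ?D. \<exists>y\<in>g ` ?D. y \<noteq> x \<and> supp V2 E2 y = supp V2 E2 x"
      unfolding ball_simps bex_simps .
    then have "\<exists>y\<in>g ` ?D. y \<noteq> x \<and> supp V2 E2 y = supp V2 E2 x" if "x \<in> g ` ?D" for x
      using that by (rule bspec)
    with edge_detect[OF ac(2) ni c card] show ?thesis by metis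
  qed
  obtain c d where cd: "leaf V2 E2 c d" "leaf V2 E2 d c" "g ` {Phi a, Psi a, Chi b, Psi b} \<subseteq> W {c, d}"
    using row[OF ab] by blast
  obtain c' d' where cd': "leaf V2 E2 c' d'" "leaf V2 E2 d' c'" "g ` {Phi b, Psi b, Chi a, Psi a} \<subseteq> W {c', d'}"
    using row[OF ab(2,1)] by blast
  have "g (Psi a) \<in> W {c, d}" "g (Psi a) \<in> W {c', d'}" using cd(3) cd'(3) by auto
  then have "{c, d} \<inter> {c', d'} \<noteq> {}" by (auto simp: W_def)
  then have same: "{c, d} = {c', d'}" using cd(1,2) cd'(1,2) by (auto simp: leaf_def)
  have sub: "g ` W {a, b} \<subseteq> W {c, d}" using cd(3) cd'(3) unfolding same by (auto simp: W_def)
  note L = leafD[OF ac(1) ab(1)] leafD[OF ac(2) cd(1)]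
  have "W {a, b} \<subseteq> W V1" using L by (intro W_mono) auto
  then have "card (g ` W {a, b}) = card (W {a, b})"
    using cycle_isoD(2)[OF g] by (meson card_image inj_on_subset)
  then have "g ` W {a, b} = W {c, d}"
    using sub L by (intro card_subset_eq) (auto simp: finite_W card_W)
  with cd that show ?thesis by blast
qed

lemma realize_edge:
  assumes ac: "acyclic_on V1 E1" "acyclic_on V2 E2" and g: "cycle_iso V1 E1 V2 E2 g"
    and ni: "\<And>v. v \<in> V2 \<Longrightarrow> nbrs V2 E2 v \<noteq> {}"
    and ab: "leaf V1 E1 a b" "leaf V1 E1 b a"
    and IH: "\<And>h K. K \<subseteq> V2 \<Longrightarrow> cycle_iso (V1 - {a, b}) E1 (V2 - K) E2 h
      \<Longrightarrow> \<exists>f. realizes (V1 - {a, b}) E1 (V2 - K) E2 h f"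
  shows "\<exists>f. realizes V1 E1 V2 E2 g f"
proof -
  obtain a' b' where ab': "leaf V2 E2 a' b'" "leaf V2 E2 b' a'" "g ` W {a, b} = W {a', b'}"
    using cycle_iso_edge[OF ac g ni ab] .
  note L = leafD[OF ac(1) ab(1)] leafD[OF ac(1) ab(2)] leafD[OF ac(2) ab'(1)] leafD[OF ac(2) ab'(2)]
  have cl: "closed_part V1 E1 {a, b}" "closed_part V2 E2 {a', b'}"
    using L by (auto simp: closed_part_def)
  have "{a', b'} \<subseteq> V2" using L by auto
  then obtain h where h: "realizes (V1 - {a, b}) E1 (V2 - {a', b'}) E2 g h"
    using IH cycle_iso_remove_part[OF g ac cl ab'(3)] by blast
  have inj: "g (Phi a) \<noteq> g (Phi b)" using cycle_iso_eq_iff[OF g, of "Phi a" "Phi b"] L by simp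
  \<comment> \<open>Either matching of the two edges is an isomorphism, so the choice only has to
    respect \<open>keeps\<close>. By \<open>uniq\<close> and \<open>excl\<close> the possible
    constraints do not conflict.\<close>
  define c where "c = (if keeps g a b' \<or> keeps g b a' then b' else a')"
  define d where "d = (if c = a' then b' else a')"
  have E: "E1 a b" "E1 b a" "\<not> E1 a a" "\<not> E1 b b" "E2 a' b'" "E2 b' a'" "\<not> E2 a' a'" "\<not> E2 b' b'"
    using L acyclic_onD(2,3)[OF ac(1)] acyclic_onD(2,3)[OF ac(2)] by (auto simp: nbrs_def)
  have "a \<noteq> b" "a' \<noteq> b'" using L by auto
  then have uniq: "\<not> (keeps g v a' \<and> keeps g v b')" for v by (auto simp: keeps_def)
  have excl: "\<not> (keeps g a z \<and> keeps g b z)" for z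
    using inj keepsD(1)[of g a z] keepsD(1)[of g b z] by auto
  have "realizes {a, b} E1 {a', b'} E2 g (\<lambda>v. if v = a then c else d)"
    unfolding realizes_def
  proof (intro conjI)
    show "bij_betw (\<lambda>v. if v = a then c else d) {a, b} {a', b'}"
      using L by (auto simp: bij_betw_def c_def d_def)
    show "\<forall>u\<in>{a, b}. \<forall>v\<in>{a, b}.
        E1 u v \<longleftrightarrow> E2 (if u = a then c else d) (if v = a then c else d)"
      using E L by (auto simp: c_def d_def)
    show "\<forall>v\<in>{a, b}. \<forall>v'\<in>{a', b'}. keeps g v v' \<longrightarrow> (if v = a then c else d) = v'"
      using excl[of a'] excl[of b'] uniq[of a] uniq[of b] \<open>a \<noteq> b\<close> by (auto simp: c_def d_def)
  qed
  then show ?thesis using realizes_combine[OF ac g cl ab'(3)] h by blast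
qed

lemma cycle_iso_no_isolated:
  assumes "acyclic_on V1 E1" "acyclic_on V2 E2" "cycle_iso V1 E1 V2 E2 g"
    "\<And>v. v \<in> V1 \<Longrightarrow> nbrs V1 E1 v \<noteq> {}" "v \<in> V2"
  shows "nbrs V2 E2 v \<noteq> {}"
  using cycle_iso_isolated[OF assms(2,1) cycle_iso_inv[OF assms(3)] assms(5)] assms(4) by blast

text \<open>An edge component or isolated vertex of the second forest would be carried back by the
  inverse of \<open>g\<close>.\<close>

lemma cycle_iso_proper_forest:
  assumes "proper_forest V1 E1" "acyclic_on V2 E2" "cycle_iso V1 E1 V2 E2 g"
  shows "proper_forest V2 E2"
proof -
  note P = proper_forestD[OF assms(1)]
  have "\<not> leaf V2 E2 b a" if ab: "leaf V2 E2 a b" for a b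
  proof
    assume ba: "leaf V2 E2 b a"
    obtain a' b' where "leaf V1 E1 a' b'" "leaf V1 E1 b' a'"
      by (rule cycle_iso_edge[OF assms(2) P(1) cycle_iso_inv[OF assms(3)] P(2) ab ba])
    then show False using P(3) by blast
  qed
  moreover have "nbrs V2 E2 v \<noteq> {}" if "v \<in> V2" for v
    using cycle_iso_no_isolated[OF P(1) assms(2,3) P(2) that] .
  ultimately show ?thesis using assms(2) unfolding proper_forest_def by blast
qed

section \<open>Removing a leaf\<close>

text \<open>A leaf in each forest, with the induction hypothesis for deleting both. The lemmas here
  assume less and less about how \<open>g\<close> aligns the leaves, each reducing to the previous
  one by composing \<open>g\<close> with an automorphism of the second matroid.\<close>

locale pendant_pair =
  fixes V1 :: "'a set" and E1 and V2 :: "'b set" and E2 and l w l' w'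
  assumes ac: "acyclic_on V1 E1" "acyclic_on V2 E2"
    and leaf: "leaf V1 E1 l w" "leaf V2 E2 l' w'"
    and IH: "\<And>h. cycle_iso (V1 - {l}) E1 (V2 - {l'}) E2 h
      \<Longrightarrow> \<exists>f. realizes (V1 - {l}) E1 (V2 - {l'}) E2 h f"
begin

lemmas L1 = leafD[OF ac(1) leaf(1)]
lemmas L2 = leafD[OF ac(2) leaf(2)]

lemma realize_aligned:
  assumes g: "cycle_iso V1 E1 V2 E2 g"
    and l: "g (Phi l) = Phi l'" "g (Psi l) = Psi l'" "g (Chi l) = Chi l'"
    and w: "g (Phi w) = Phi w'" "{g (Chi w), g (Psi w)} = {Chi w', Psi w'}"
  shows "\<exists>f. realizes V1 E1 V2 E2 g f"
proof -
  have "g ` W {l} = W {l'}" using l by (simp add: W_single)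
  then have "cycle_iso (V1 - {l}) E1 (V2 - {l'}) E2 g"
    by (rule cycle_iso_remove_vertex[OF g acyclic_onD(1)[OF ac(1)] acyclic_onD(1)[OF ac(2)] L1(1) L2(1) l(1)])
  then obtain f where f: "realizes (V1 - {l}) E1 (V2 - {l'}) E2 g f" using IH by blast
  then have bij: "bij_betw f (V1 - {l}) (V2 - {l'})"
    and edge: "\<And>u v. u \<in> V1 - {l} \<Longrightarrow> v \<in> V1 - {l} \<Longrightarrow> E1 u v \<longleftrightarrow> E2 (f u) (f v)"
    and keep: "\<And>v v'. v \<in> V1 - {l} \<Longrightarrow> v' \<in> V2 - {l'} \<Longrightarrow> keeps g v v' \<Longrightarrow> f v = v'"
    by (auto simp: realizes_def)
  have wV: "w \<in> V1 - {l}" "w' \<in> V2 - {l'}" using L1 L2 by auto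
  \<comment> \<open>The \<open>keeps\<close> clause of \<open>realizes\<close> serves this step:
    \<open>w\<close> must go to the vertex at which \<open>l'\<close> is attached again.\<close>
  have fw: "f w = w'" using keep[OF wV] w by (simp add: keeps_def)
  have fV: "f v \<in> V2 - {l'}" if "v \<in> V1 - {l}" for v using bij that by (auto simp: bij_betw_def)
  define k where "k v = (if v = l then l' else f v)" for v
  have E1l: "E1 u l \<longleftrightarrow> u = w" "E1 l u \<longleftrightarrow> u = w" if "u \<in> V1" for u
    using L1(3) that acyclic_onD(2)[OF ac(1) that L1(1)] by (auto simp: nbrs_def)
  have E2l: "E2 u l' \<longleftrightarrow> u = w'" "E2 l' u \<longleftrightarrow> u = w'" if "u \<in> V2" for u
    using L2(3) that acyclic_onD(2)[OF ac(2) that L2(1)] by (auto simp: nbrs_def)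
  have few: "f v = w' \<longleftrightarrow> v = w" if "v \<in> V1 - {l}" for v
    using bij that wV(1) fw by (auto simp: bij_betw_def dest: inj_onD)
  have "bij_betw k ({l} \<union> (V1 - {l})) ({l'} \<union> (V2 - {l'}))"
  proof (rule bij_betw_combine)
    show "bij_betw k {l} {l'}" by (simp add: k_def bij_betw_def)
    show "bij_betw k (V1 - {l}) (V2 - {l'})"
      using bij by (subst bij_betw_cong[where g = f]) (auto simp: k_def)
  qed auto
  moreover have "{l} \<union> (V1 - {l}) = V1" "{l'} \<union> (V2 - {l'}) = V2" using L1 L2 by auto
  moreover have "E1 u v \<longleftrightarrow> E2 (k u) (k v)" if uv: "u \<in> V1" "v \<in> V1" for u v
  proof -
    have irr: "\<not> E1 l l" "\<not> E2 l' l'" 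
      using acyclic_onD(3)[OF ac(1) L1(1)] acyclic_onD(3)[OF ac(2) L2(1)] by simp_all
    consider "u = l" "v = l" | "u = l" "v \<noteq> l" | "u \<noteq> l" "v = l" | "u \<noteq> l" "v \<noteq> l" by blast
    then show ?thesis
    proof cases
      case 1
      then show ?thesis using irr by (simp add: k_def)
    next
      case 2
      then show ?thesis using E1l(2)[OF uv(2)] E2l(2)[of "f v"] fV[of v] few[of v] uv by (simp add: k_def)
    next
      case 3
      then show ?thesis using E1l(1)[OF uv(1)] E2l(1)[of "f u"] fV[of u] few[of u] uv by (simp add: k_def)
    next
      case 4
      then show ?thesis using edge[of u v] uv by (simp add: k_def)
    qed
  qed
  moreover have "k v = v'" if v: "v \<in> V1" "v' \<in> V2" "keeps g v v'" for v v'
  proof (cases "v = l")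
    case True
    then show ?thesis using keepsD(1)[OF v(3)] l(1) by (simp add: k_def)
  next
    case False
    then have "g (Phi v) \<noteq> g (Phi l)" using cycle_iso_eq_iff[OF g] v L1 by simp
    then have "v' \<noteq> l'" using keepsD(1)[OF v(3)] l(1) by auto
    then show ?thesis using keep[of v v'] v False by (simp add: k_def)
  qed
  ultimately show ?thesis by (auto simp: realizes_def)
qed

text \<open>Local complementation at \<open>l'\<close> repairs an exchange of \<open>Phi l\<close>
  and \<open>Psi l\<close>. Its effect on \<open>Chi w'\<close> and \<open>Psi w'\<close> is
  absorbed by the unordered pair.\<close>

lemma realize_up_to_local_swap:
  assumes g: "cycle_iso V1 E1 V2 E2 g"
    and l: "{g (Phi l), g (Psi l)} = {Phi l', Psi l'}" "g (Chi l) = Chi l'"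
    and w: "g (Phi w) = Phi w'" "{g (Chi w), g (Psi w)} = {Chi w', Psi w'}"
  shows "\<exists>f. realizes V1 E1 V2 E2 g f"
proof (cases "g (Phi l) = Phi l'")
  case True
  then have "g (Psi l) = Psi l'" using l(1) by (auto simp: doubleton_eq_iff)
  then show ?thesis using realize_aligned[OF g] True l(2) w by simp
next
  case False
  then have l': "g (Phi l) = Psi l'" "g (Psi l) = Phi l'" using l(1) by (auto simp: doubleton_eq_iff)
  let ?s = "local_swap l' w'"
  have "cycle_iso V1 E1 V2 E2 (?s \<circ> g)"
    using cycle_iso_comp[OF g local_swap_cycle_iso[OF ac(2) leaf(2)]] .
  moreover have "{(?s \<circ> g) (Chi w), (?s \<circ> g) (Psi w)} = ?s ` {g (Chi w), g (Psi w)}" by simp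
  then have "{(?s \<circ> g) (Chi w), (?s \<circ> g) (Psi w)} = {Chi w', Psi w'}"
    unfolding w(2) using L2(5) by auto
  ultimately obtain f where f: "realizes V1 E1 V2 E2 (?s \<circ> g) f"
    using realize_aligned[of "?s \<circ> g"] l' l(2) w(1) L2(5) by fastforce
  \<comment> \<open>\<open>Phi l'\<close> is already the image of \<open>Psi l\<close>, so no
    constraint ends at \<open>l'\<close>. Elsewhere \<open>?s\<close> fixes \<open>Phi u'\<close>
    and at most exchanges \<open>Chi u'\<close> with \<open>Psi u'\<close>.\<close>
  have "keeps (?s \<circ> g) u u'" if u: "u \<in> V1" "u' \<in> V2" "keeps g u u'" for u u'
  proof -
    have "u' \<noteq> l'"
    proof
      assume "u' = l'"
      then have "g (Phi u) = g (Psi l)" using keepsD(1)[OF u(3)] l' by simp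
      then show False using cycle_iso_eq_iff[OF g] u L1 by simp
    qed
    then show ?thesis using u(3) by (intro keeps_comp) auto
  qed
  then have "realizes V1 E1 V2 E2 g f" using f by (rule realizes_comp)
  then show ?thesis by blast
qed

text \<open>\<open>Chi l\<close> is parallel to \<open>Phi w\<close> and therefore goes to
  \<open>Chi m\<close> for some leaf \<open>m\<close> at \<open>w'\<close>. The parallel elements
  \<open>Chi m\<close> and \<open>Chi l'\<close> are then exchanged.\<close>

lemma realize_up_to_leaf_swap:
  assumes g: "cycle_iso V1 E1 V2 E2 g"
    and l: "{g (Phi l), g (Psi l)} = {Phi l', Psi l'}"
    and w: "g (Phi w) = Phi w'" "{g (Chi w), g (Psi w)} = {Chi w', Psi w'}"
  shows "\<exists>f. realizes V1 E1 V2 E2 g f"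
proof -
  have "supp V1 E1 (Chi l) = supp V1 E1 (Phi w)" using L1 by (simp add: supp_Phi supp_Chi)
  then have "supp V2 E2 (g (Chi l)) = {w'}"
    using cycle_iso_supp_eq[OF g, of "Chi l" "Phi w"] L1 L2 w(1) by (simp add: supp_Phi)
  moreover have "g (Chi l) \<in> W V2" using cycle_isoD(4)[OF g] L1 by simp
  moreover have "g (Chi l) \<noteq> Phi w'" using w(1) cycle_iso_eq_iff[OF g, of "Chi l" "Phi w"] L1 by auto
  moreover have "nbrs V2 E2 w' \<noteq> {}" using L2(4) by auto
  ultimately obtain m where m: "leaf V2 E2 m w'" "g (Chi l) = Chi m"
    using supp_eq_singleton[OF ac(2)] by metis
  note Lm = leafD[OF ac(2) m(1)]
  let ?s = "swap (Chi m) (Chi l')"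
  show ?thesis
  proof (cases "m = l'")
    case True
    then show ?thesis using realize_up_to_local_swap[OF g] m l w by simp
  next
    case False
    have "cycle_iso V2 E2 V2 E2 ?s"
      by (rule swap_cycle_iso) (use L2 Lm in \<open>auto simp: supp_Chi\<close>)
    then have "cycle_iso V1 E1 V2 E2 (?s \<circ> g)" by (rule cycle_iso_comp[OF g])
    moreover have "{(?s \<circ> g) (Chi w), (?s \<circ> g) (Psi w)} = ?s ` {g (Chi w), g (Psi w)}" by simp
    then have "{(?s \<circ> g) (Chi w), (?s \<circ> g) (Psi w)} = {Chi w', Psi w'}"
      unfolding w(2) using L2(5) Lm(5) by (simp add: swap_def)
    moreover have "{(?s \<circ> g) (Phi l), (?s \<circ> g) (Psi l)} = ?s ` {g (Phi l), g (Psi l)}" by simp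
    then have "{(?s \<circ> g) (Phi l), (?s \<circ> g) (Psi l)} = {Phi l', Psi l'}"
      unfolding l by (simp add: swap_def)
    moreover have "(?s \<circ> g) (Chi l) = Chi l'" "(?s \<circ> g) (Phi w) = Phi w'"
      using m w(1) by (simp_all add: swap_def)
    ultimately obtain f where f: "realizes V1 E1 V2 E2 (?s \<circ> g) f"
      using realize_up_to_local_swap[of "?s \<circ> g"] by blast
    have "keeps (?s \<circ> g) u u'" if u: "u \<in> V1" "u' \<in> V2" "keeps g u u'" for u u'
    proof -
      \<comment> \<open>A constraint ending at \<open>m\<close> or \<open>l'\<close> would have to
        start at \<open>l\<close> and then end at both, although these differ.\<close>
      have "u = l" if "u' = m \<or> u' = l'"
        using that
      proof
        assume "u' = m"
        then have "g (Chi l) = g (Chi u) \<or> g (Chi l) = g (Psi u)" using keepsD(3)[OF u(3)] m(2) by simp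
        then show ?thesis using cycle_iso_eq_iff[OF g] u L1 by auto
      next
        assume "u' = l'"
        then have "g (Phi u) = g (Phi l) \<or> g (Phi u) = g (Psi l)"
          using keepsD(1)[OF u(3)] l by (auto simp: doubleton_eq_iff)
        then show ?thesis using cycle_iso_eq_iff[OF g] u L1 by auto
      qed
      moreover have False if ul: "u = l"
      proof -
        have "u' = m" using keepsD(5)[OF u(3)] m(2) ul by auto
        moreover have "u' = l'" using keepsD(1)[OF u(3)] l ul by (auto simp: doubleton_eq_iff)
        ultimately show False using False by simp
      qed
      ultimately have "u' \<noteq> m" "u' \<noteq> l'" by blast+
      then show ?thesis using u(3) by (intro keeps_comp) (auto simp: swap_def)
    qed
    then have "realizes V1 E1 V2 E2 g f" using f by (rule realizes_comp)
    then show ?thesis by blast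
  qed
qed

text \<open>By its column, \<open>g (Phi w)\<close> is \<open>Phi w'\<close> or \<open>Chi m\<close>
  for a leaf \<open>m\<close> at \<open>w'\<close>. In the second case these two parallel elements
  are exchanged.\<close>

lemma realize_pendant:
  assumes g: "cycle_iso V1 E1 V2 E2 g"
    and l: "{g (Phi l), g (Psi l)} = {Phi l', Psi l'}"
    and w: "{g (Chi w), g (Psi w)} = {Chi w', Psi w'}"
    and supp: "supp V2 E2 (g (Phi w)) = {w'}"
  shows "\<exists>f. realizes V1 E1 V2 E2 g f"
proof (cases "g (Phi w) = Phi w'")
  case True
  then show ?thesis using realize_up_to_leaf_swap[OF g l] w by simp
next
  case False
  have "g (Phi w) \<in> W V2" using cycle_isoD(4)[OF g] L1 by simp
  moreover have "nbrs V2 E2 w' \<noteq> {}" using L2(4) by auto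
  ultimately obtain m where m: "leaf V2 E2 m w'" "g (Phi w) = Chi m"
    using supp_eq_singleton[OF ac(2) _ supp] False by metis
  note Lm = leafD[OF ac(2) m(1)]
  let ?s = "swap (Chi m) (Phi w')"
  have "cycle_iso V2 E2 V2 E2 ?s"
    by (rule swap_cycle_iso) (use L2 Lm in \<open>auto simp: supp_Chi supp_Phi\<close>)
  then have "cycle_iso V1 E1 V2 E2 (?s \<circ> g)" by (rule cycle_iso_comp[OF g])
  moreover have "{(?s \<circ> g) (Chi w), (?s \<circ> g) (Psi w)} = ?s ` {g (Chi w), g (Psi w)}" by simp
  then have "{(?s \<circ> g) (Chi w), (?s \<circ> g) (Psi w)} = {Chi w', Psi w'}"
    unfolding w using Lm(5) by (simp add: swap_def)
  moreover have "{(?s \<circ> g) (Phi l), (?s \<circ> g) (Psi l)} = ?s ` {g (Phi l), g (Psi l)}" by simp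
  then have "{(?s \<circ> g) (Phi l), (?s \<circ> g) (Psi l)} = {Phi l', Psi l'}"
    unfolding l using L2(5) by (simp add: swap_def)
  moreover have "(?s \<circ> g) (Phi w) = Phi w'"
    using m by (simp add: swap_def)
  ultimately obtain f where f: "realizes V1 E1 V2 E2 (?s \<circ> g) f"
    using realize_up_to_leaf_swap[of "?s \<circ> g"] by blast
  have "keeps (?s \<circ> g) u u'" if u: "u \<in> V1" "u' \<in> V2" "keeps g u u'" for u u'
  proof -
    have "u' \<noteq> m"
    proof
      assume "u' = m"
      then have "g (Phi w) = g (Chi u) \<or> g (Phi w) = g (Psi u)" using keepsD(3)[OF u(3)] m(2) by simp
      then show False using cycle_iso_eq_iff[OF g] u L1 by auto
    qed
    moreover have "u' \<noteq> w'"
    proof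
      assume "u' = w'"
      then have "g (Chi u) \<in> {g (Chi w), g (Psi w)}" using keepsD(5)[OF u(3)] unfolding w by auto
      then have "u = w" using cycle_iso_eq_iff[OF g] u L1 by auto
      then show False using keepsD(1)[OF u(3)] m(2) by simp
    qed
    ultimately show ?thesis using u(3) by (intro keeps_comp) (auto simp: swap_def)
  qed
  then have "realizes V1 E1 V2 E2 g f" using f by (rule realizes_comp)
  then show ?thesis by blast
qed

end

section \<open>The image of the cocycle of a leaf\<close>

lemma complement_pair:
  assumes "{a, b, c, d} = {p, q, r, s}" "{a, b} = {p, q}"
    "distinct [a, b, c, d]" "distinct [p, q, r, s]"
  shows "{c, d} = {r, s}"
proof -
  have "{c, d} = {a, b, c, d} - {a, b}" using assms(3) by auto
  also have "\<dots> = {p, q, r, s} - {p, q}" unfolding assms(1,2) ..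
  also have "\<dots> = {r, s}" using assms(4) by auto
  finally show ?thesis .
qed

lemma leaf_not_centre:
  assumes "proper_forest V E" "leaf V E l w"
  shows "\<not> leaf V E w c"
proof
  assume w: "leaf V E w c"
  then have "c = l" using leafD[OF proper_forestD(1)[OF assms(1)] assms(2)] by (auto simp: leaf_def)
  then show False using w proper_forestD(3)[OF assms] by simp
qed

text \<open>Pairs of either kind add up to the unit vector at \<open>w\<close>.\<close>

definition star_pair :: "'a set \<Rightarrow> ('a \<Rightarrow> 'a \<Rightarrow> bool) \<Rightarrow> 'a \<Rightarrow> 'a welem \<Rightarrow> 'a welem \<Rightarrow> bool" where
  "star_pair V E w x y \<longleftrightarrow>
     {x, y} = {Chi w, Psi w} \<or> (\<exists>m. leaf V E m w \<and> {x, y} = {Phi m, Psi m})"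

text \<open>The exceptional split from \<open>pendant_split\<close>: both pairs add up to the
  neighbours of \<open>w\<close> other than \<open>l\<close>.\<close>

definition crossed_pair :: "'a \<Rightarrow> 'a \<Rightarrow> 'a welem \<Rightarrow> 'a welem \<Rightarrow> 'a welem \<Rightarrow> 'a welem \<Rightarrow> bool" where
  "crossed_pair l w x y z t \<longleftrightarrow>
     {x, y} = {Phi l, Chi w} \<and> {z, t} = {Psi l, Psi w} \<or>
     {x, y} = {Psi l, Psi w} \<and> {z, t} = {Phi l, Chi w}"

text \<open>\<open>Phi l\<close>, \<open>Psi l\<close> and \<open>Phi w\<close> form a zero-sum
  triple and \<open>Chi l\<close> is parallel to \<open>Phi w\<close>; \<open>g\<close> preserves
  both relations.\<close>

lemma pendant_supp_image:
  assumes ac: "acyclic_on V1 E1" and g: "cycle_iso V1 E1 V2 E2 g" and l: "leaf V1 E1 l w"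
  shows "supp V2 E2 (g (Phi w)) = sym_diff (supp V2 E2 (g (Phi l))) (supp V2 E2 (g (Psi l)))"
    "supp V2 E2 (g (Chi l)) = supp V2 E2 (g (Phi w))"
proof -
  note L = leafD[OF ac l]
  show "supp V2 E2 (g (Phi w)) = sym_diff (supp V2 E2 (g (Phi l))) (supp V2 E2 (g (Psi l)))"
  proof (rule cycle_iso_supp_sym_diff[OF g])
    show "supp V1 E1 (Phi w) = sym_diff (supp V1 E1 (Phi l)) (supp V1 E1 (Psi l))"
      using L by (auto simp: supp_Phi supp_Psi[OF ac])
  qed (use L in auto)
  show "supp V2 E2 (g (Chi l)) = supp V2 E2 (g (Phi w))"
    using cycle_iso_supp_eq[OF g, of "Chi l" "Phi w"] L by (simp add: supp_Phi supp_Chi)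
qed

text \<open>The image of \<open>Phi w\<close> has the image of \<open>Chi l\<close> as a parallel
  partner, so \<open>parallel_cases\<close> applies.\<close>

lemma pendant_supp_image_single:
  assumes P: "proper_forest V1 E1" "proper_forest V2 E2"
    and g: "cycle_iso V1 E1 V2 E2 g" and l: "leaf V1 E1 l w"
  obtains m u where "leaf V2 E2 m u" "supp V2 E2 (g (Phi w)) = {u}"
proof -
  note ac = proper_forestD(1)[OF P(1)]
  note L = leafD[OF ac l]
  have "g (Phi w) \<noteq> g (Chi l)" using cycle_iso_eq_iff[OF g, of "Phi w" "Chi l"] L by simp
  moreover have "g (Phi w) \<in> W V2" "g (Chi l) \<in> W V2" using cycle_isoD(4)[OF g] L by auto
  ultimately show ?thesis
    using parallel_cases[OF P(2), of "g (Phi w)" "g (Chi l)"] pendant_supp_image(2)[OF ac g l] that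
    by metis
qed

text \<open>The row of \<open>l\<close> goes to a four-element cocycle in which the images of
  \<open>Phi l\<close> and \<open>Psi l\<close> add up to a single vertex. The classification and
  the two split lemmas leave only these outcomes.\<close>

lemma pendant_image:
  assumes P: "proper_forest V1 E1" "proper_forest V2 E2"
    and g: "cycle_iso V1 E1 V2 E2 g" and l: "leaf V1 E1 l w"
  obtains
    (straight) w' where "supp V2 E2 (g (Phi w)) = {w'}"
      "star_pair V2 E2 w' (g (Phi l)) (g (Psi l))" "star_pair V2 E2 w' (g (Chi w)) (g (Psi w))"
  | (crossed) l' w' m' u' where "supp V2 E2 (g (Phi w)) = {u'}" "leaf V2 E2 l' w'" "leaf V2 E2 m' u'"
      "nbrs V2 E2 w' = {l', u'}"
      "g ` {Phi l, Psi l, Chi w, Psi w} = {Phi l', Psi l', Chi w', Psi w'}"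
      "crossed_pair l' w' (g (Phi l)) (g (Psi l)) (g (Chi w)) (g (Psi w))"
proof -
  note ac = proper_forestD(1)[OF P(1)]
  note L = leafD[OF ac l]
  let ?D = "{Phi l, Psi l, Chi w, Psi w}"
  obtain m' u' where u': "leaf V2 E2 m' u'" "supp V2 E2 (g (Phi w)) = {u'}"
    using pendant_supp_image_single[OF P g l] .
  have sd: "sym_diff (supp V2 E2 (g (Phi l))) (supp V2 E2 (g (Psi l))) = {u'}"
    using pendant_supp_image(1)[OF ac g l] u'(2) by simp
  have co: "cocycle V2 E2 (g ` ?D)" using cycle_iso_cocycle[OF g pendant_cocycle(1)[OF ac l]] .
  have "?D \<subseteq> W V1" using L by simp
  then have "card (g ` ?D) = card ?D" using cycle_isoD(2)[OF g] by (meson card_image inj_on_subset)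
  then have card: "card (g ` ?D) = 4" using pendant_cocycle(2)[OF ac l] by simp
  have dist: "distinct [g (Phi l), g (Psi l), g (Chi w), g (Psi w)]"
    using cycle_iso_eq_iff[OF g] L by auto
  have im: "g ` ?D = {g (Phi l), g (Psi l), g (Chi w), g (Psi w)}" by simp
  have mem: "g (Phi l) \<in> g ` ?D" "g (Psi l) \<in> g ` ?D" by auto
  have ne: "g (Phi l) \<noteq> g (Psi l)" using dist by simp
  note P2 = proper_forestD[OF P(2)]
  show thesis
  proof (rule cocycle_card_4[OF P2(1,2) co card])
    fix l' w' assume *: "leaf V2 E2 l' w'" "g ` ?D = {Phi l', Psi l', Chi w', Psi w'}"
    note L' = leafD[OF P2(1) *(1)]
    have eq: "{g (Phi l), g (Psi l), g (Chi w), g (Psi w)} = {Phi l', Psi l', Chi w', Psi w'}"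
      using *(2) im by simp
    have compl: "{g (Chi w), g (Psi w)} = {r, s}"
      if "{g (Phi l), g (Psi l)} = {p, q}" "{Phi l', Psi l', Chi w', Psi w'} = {p, q, r, s}"
        "distinct [p, q, r, s]" for p q r s
      using complement_pair[OF _ that(1) dist that(3)] eq that(2) by simp
    from pendant_split[OF P(2) *(1) mem[unfolded *(2)] ne sd]
    consider "u' = w'" "{g (Phi l), g (Psi l)} = {Phi l', Psi l'}"
      | "u' = w'" "{g (Phi l), g (Psi l)} = {Chi w', Psi w'}"
      | "nbrs V2 E2 w' = {l', u'}" "{g (Phi l), g (Psi l)} = {Phi l', Chi w'}"
      | "nbrs V2 E2 w' = {l', u'}" "{g (Phi l), g (Psi l)} = {Psi l', Psi w'}" by blast
    then show thesis
    proof cases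
      case 1
      have "{g (Chi w), g (Psi w)} = {Chi w', Psi w'}"
        using compl[OF 1(2)] L'(5) by auto
      then show thesis using straight[of w'] u'(2) 1 *(1) unfolding star_pair_def by blast
    next
      case 2
      have "{g (Chi w), g (Psi w)} = {Phi l', Psi l'}"
        using compl[OF 2(2)] L'(5) by auto
      then show thesis using straight[of w'] u'(2) 2 *(1) unfolding star_pair_def by blast
    next
      case 3
      have "{g (Chi w), g (Psi w)} = {Psi l', Psi w'}"
        using compl[OF 3(2)] L'(5) by auto
      then show thesis using crossed[OF u'(2) *(1) u'(1) 3(1) *(2)] 3(2)
        unfolding crossed_pair_def by blast
    next
      case 4
      have "{g (Chi w), g (Psi w)} = {Phi l', Chi w'}"
        using compl[OF 4(2)] L'(5) by auto
      then show thesis using crossed[OF u'(2) *(1) u'(1) 4(1) *(2)] 4(2)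
        unfolding crossed_pair_def by blast
    qed
  next
    fix l1 l2 w' assume *: "leaf V2 E2 l1 w'" "leaf V2 E2 l2 w'" "l1 \<noteq> l2"
      "g ` ?D = {Phi l1, Psi l1, Phi l2, Psi l2}"
    have eq: "{g (Phi l), g (Psi l), g (Chi w), g (Psi w)} = {Phi l1, Psi l1, Phi l2, Psi l2}"
      using *(4) im by simp
    have compl: "{g (Chi w), g (Psi w)} = {r, s}"
      if "{g (Phi l), g (Psi l)} = {p, q}" "{Phi l1, Psi l1, Phi l2, Psi l2} = {p, q, r, s}"
        "distinct [p, q, r, s]" for p q r s
      using complement_pair[OF _ that(1) dist that(3)] eq that(2) by simp
    from twins_split[OF P2(1) *(1-3) mem[unfolded *(4)] ne sd]
    consider "u' = w'" "{g (Phi l), g (Psi l)} = {Phi l1, Psi l1}"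
      | "u' = w'" "{g (Phi l), g (Psi l)} = {Phi l2, Psi l2}" by blast
    then show thesis
    proof cases
      case 1
      have "{g (Chi w), g (Psi w)} = {Phi l2, Psi l2}"
        using compl[OF 1(2)] *(3) by auto
      then show thesis using straight[of w'] u'(2) 1 *(1,2) unfolding star_pair_def by blast
    next
      case 2
      have "{g (Chi w), g (Psi w)} = {Phi l1, Psi l1}"
        using compl[OF 2(2)] *(3) by auto
      then show thesis using straight[of w'] u'(2) 2 *(1,2) unfolding star_pair_def by blast
    qed
  next
    fix a b assume "leaf V2 E2 a b" "leaf V2 E2 b a"
    then show thesis using P2(3) by blast
  qed
qed

lemma realize_straight:
  assumes ac: "acyclic_on V1 E1" "acyclic_on V2 E2"
    and g: "cycle_iso V1 E1 V2 E2 g" and l: "leaf V1 E1 l w"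
    and w': "w' \<in> V2"
    and supp: "supp V2 E2 (g (Phi w)) = {w'}"
    and pl: "star_pair V2 E2 w' (g (Phi l)) (g (Psi l))"
    and pw: "star_pair V2 E2 w' (g (Chi w)) (g (Psi w))"
    and IH: "\<And>h l'. l' \<in> V2 \<Longrightarrow> cycle_iso (V1 - {l}) E1 (V2 - {l'}) E2 h
      \<Longrightarrow> \<exists>f. realizes (V1 - {l}) E1 (V2 - {l'}) E2 h f"
  shows "\<exists>f. realizes V1 E1 V2 E2 g f"
proof -
  note L = leafD[OF ac(1) l]
  have dist: "{g (Phi l), g (Psi l)} \<inter> {g (Chi w), g (Psi w)} = {}"
    using cycle_iso_eq_iff[OF g] L by auto
  have loc: "pendant_pair V1 E1 V2 E2 l w m w'" if m: "leaf V2 E2 m w'" for m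
    by unfold_locales (use ac l m IH leafD(1)[OF ac(2) m] in auto)
  from pw consider "{g (Chi w), g (Psi w)} = {Chi w', Psi w'}"
    | m where "leaf V2 E2 m w'" "{g (Chi w), g (Psi w)} = {Phi m, Psi m}"
    unfolding star_pair_def by blast
  then show ?thesis
  proof cases
    case 1
    then have "{g (Phi l), g (Psi l)} \<noteq> {Chi w', Psi w'}" using dist by auto
    then obtain m where "leaf V2 E2 m w'" "{g (Phi l), g (Psi l)} = {Phi m, Psi m}"
      using pl unfolding star_pair_def by blast
    then show ?thesis using pendant_pair.realize_pendant[OF loc g _ 1 supp] by blast
  next
    \<comment> \<open>The pair \<open>Chi w\<close>, \<open>Psi w\<close> lands on a leaf
      \<open>m\<close>. Pivoting on its edge moves that pair to \<open>w'\<close> and makes the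
      image of \<open>Phi l\<close>, \<open>Psi l\<close> the pair of some leaf.\<close>
    case (2 m)
    note Lm = leafD[OF ac(2) 2(1)]
    let ?s = "pivot m w'"
    have h: "cycle_iso V1 E1 V2 E2 (?s \<circ> g)"
      by (rule cycle_iso_comp[OF g pivot_cycle_iso[OF ac(2) 2(1)]])
    have hw: "{(?s \<circ> g) (Chi w), (?s \<circ> g) (Psi w)} = {Chi w', Psi w'}"
    proof -
      have "{(?s \<circ> g) (Chi w), (?s \<circ> g) (Psi w)} = ?s ` {g (Chi w), g (Psi w)}" by simp
      then show ?thesis unfolding 2(2) by simp
    qed
    have hl: "\<exists>n. leaf V2 E2 n w' \<and> {(?s \<circ> g) (Phi l), (?s \<circ> g) (Psi l)} = {Phi n, Psi n}"
    proof -
      have im: "{(?s \<circ> g) (Phi l), (?s \<circ> g) (Psi l)} = ?s ` {g (Phi l), g (Psi l)}" by simp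
      from pl consider "{g (Phi l), g (Psi l)} = {Chi w', Psi w'}"
        | n where "leaf V2 E2 n w'" "{g (Phi l), g (Psi l)} = {Phi n, Psi n}"
        unfolding star_pair_def by blast
      then show ?thesis
      proof cases
        case 1
        then have "{(?s \<circ> g) (Phi l), (?s \<circ> g) (Psi l)} = {Phi m, Psi m}"
          unfolding im using Lm(5) by simp
        then show ?thesis using 2(1) by blast
      next
        case (2 n)
        have "n \<noteq> m" using dist 2(2) \<open>{g (Chi w), g (Psi w)} = {Phi m, Psi m}\<close> by auto
        moreover have "n \<noteq> w'" using leafD(5)[OF ac(2) 2(1)] .
        ultimately have "{(?s \<circ> g) (Phi l), (?s \<circ> g) (Psi l)} = {Phi n, Psi n}"
          unfolding im 2(2) by simp
        then show ?thesis using 2(1) by blast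
      qed
    qed
    have "supp V2 E2 (pivot m w' (g (Phi w))) = {w'}"
      using cycle_iso_supp_eq[OF pivot_cycle_iso[OF ac(2) 2(1)], of "g (Phi w)" "Phi w'"]
        cycle_isoD(4)[OF g, of "Phi w"] L supp w' Lm by (simp add: supp_Phi supp_Chi)
    then have hs: "supp V2 E2 ((?s \<circ> g) (Phi w)) = {w'}" by simp
    obtain f where f: "realizes V1 E1 V2 E2 (?s \<circ> g) f"
      using pendant_pair.realize_pendant[OF loc h _ hw hs] hl by blast
    have "keeps (?s \<circ> g) u u'" if u: "u \<in> V1" "u' \<in> V2" "keeps g u u'" for u u'
    proof -
      have "u' \<noteq> m"
      proof
        assume "u' = m"
        then have "g (Phi u) \<in> {g (Chi w), g (Psi w)}" using keepsD(1)[OF u(3)] unfolding 2(2) by simp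
        then show False using cycle_iso_eq_iff[OF g] u L by auto
      qed
      moreover have "u' \<noteq> w'"
      proof
        assume uw: "u' = w'"
        \<comment> \<open>With a constraint at \<open>w'\<close>, the preimage of the cocycle of
          \<open>m\<close> would be a cocycle without \<open>Phi\<close> elements.\<close>
        let ?C = "{Chi w, Psi w, Chi u, Psi u}"
        have C: "?C \<subseteq> W V1" using u L by simp
        have gC: "g ` ?C = {Phi m, Psi m, Chi w', Psi w'}"
          using 2(2) keepsD(2)[OF u(3)] uw by auto
        have "inv_into (W V1) g ` {Phi m, Psi m, Chi w', Psi w'} = ?C"
          unfolding gC[symmetric] using C cycle_isoD(2)[OF g] by (rule inv_into_image_cancel[rotated])
        then have "cocycle V1 E1 ?C"
          using cycle_iso_cocycle[OF cycle_iso_inv[OF g] pendant_cocycle(1)[OF ac(2) 2(1)]] by simp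
        then show False using cocycle_has_Phi[OF ac(1), of ?C] by blast
      qed
      ultimately show ?thesis using u(3) by (intro keeps_comp) auto
    qed
    then have "realizes V1 E1 V2 E2 g f" using f by (rule realizes_comp)
    then show ?thesis by blast
  qed
qed

section \<open>The crossed case: paths on four vertices\<close>

text \<open>A crossed image spreads each of the pairs \<open>Phi l\<close>, \<open>Psi l\<close> and
  \<open>Chi w\<close>, \<open>Psi w\<close> over two vertices, so no constraint starts at
  \<open>l\<close> or \<open>w\<close>.\<close>

lemma crossed_pair_not_keeps:
  assumes "crossed_pair l' w' (g (Phi l)) (g (Psi l)) (g (Chi w)) (g (Psi w))" "l' \<noteq> w'"
  shows "\<not> keeps g l v'" "\<not> keeps g w v'"
  using assms by (auto simp: crossed_pair_def keeps_def doubleton_eq_iff)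

text \<open>Apply \<open>pendant_image\<close> to the inverse of \<open>g\<close> and the leaf
  \<open>m'\<close>. Its crossed outcome is the claim; its straight outcome is
  contradictory.\<close>

lemma crossed_other_pendant:
  assumes P: "proper_forest V1 E1" "proper_forest V2 E2"
    and g: "cycle_iso V1 E1 V2 E2 g" and l: "leaf V1 E1 l w"
    and u': "supp V2 E2 (g (Phi w)) = {u'}" and l': "leaf V2 E2 l' w'" and m': "leaf V2 E2 m' u'"
    and N: "nbrs V2 E2 w' = {l', u'}"
    and D: "g ` {Phi l, Psi l, Chi w, Psi w} = {Phi l', Psi l', Chi w', Psi w'}"
    and X: "crossed_pair l' w' (g (Phi l)) (g (Psi l)) (g (Chi w)) (g (Psi w))"
  obtains k z where "leaf V1 E1 k z" "nbrs V1 E1 z = {k, w}"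
    "g ` {Phi k, Psi k, Chi z, Psi z} = {Phi m', Psi m', Chi u', Psi u'}"
proof -
  note ac = proper_forestD(1)[OF P(1)] proper_forestD(1)[OF P(2)]
  note L = leafD[OF ac(1) l] leafD[OF ac(2) l'] leafD[OF ac(2) m']
  define gi where "gi = inv_into (W V1) g"
  have gi: "cycle_iso V2 E2 V1 E1 gi" unfolding gi_def by (rule cycle_iso_inv[OF g])
  have gig: "gi (g x) = x" if "x \<in> W V1" for x
    using cycle_isoD(2)[OF g] that by (simp add: gi_def)
  have ggi: "g (gi y) = y" if "y \<in> W V2" for y
    using cycle_isoD(3)[OF g] that by (simp add: gi_def f_inv_into_f)
  have "u' \<noteq> w'" using N nbrs_irrefl[OF ac(2), of w'] by auto
  moreover have "m' \<noteq> w'" "l' \<noteq> u'" using leaf_not_centre[OF P(2)] l' m' by blast+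
  moreover have "l' \<noteq> m'" using L \<open>u' \<noteq> w'\<close> by auto
  ultimately have disj: "{Phi l', Psi l', Chi w', Psi w'} \<inter> {Phi m', Psi m', Chi u', Psi u'} = {}"
    by auto
  have "supp V1 E1 (gi (Phi u')) = supp V1 E1 (gi (g (Phi w)))"
    using cycle_iso_supp_eq[OF gi, of "Phi u'" "g (Phi w)"] cycle_isoD(4)[OF g, of "Phi w"] L u'
    by (simp add: supp_Phi)
  then have supp_gi: "supp V1 E1 (gi (Phi u')) = {w}" using L by (simp add: gig supp_Phi)
  show thesis
  proof (rule pendant_image[OF P(2,1) gi m'])
    fix w1 assume w1: "supp V1 E1 (gi (Phi u')) = {w1}"
      "star_pair V1 E1 w1 (gi (Phi m')) (gi (Psi m'))" "star_pair V1 E1 w1 (gi (Chi u')) (gi (Psi u'))"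
    have "w1 = w" using w1(1) supp_gi by simp
    \<comment> \<open>The two pairs differ, so at most one is \<open>Chi w\<close>,
      \<open>Psi w\<close> and the other belongs to a leaf \<open>n\<close> at
      \<open>w\<close>.\<close>
    have "gi (Phi m') \<noteq> gi (Chi u') \<and> gi (Phi m') \<noteq> gi (Psi u')"
      using cycle_iso_eq_iff[OF gi] L by simp
    then have "{gi (Phi m'), gi (Psi m')} \<noteq> {gi (Chi u'), gi (Psi u')}" by auto
    then obtain n where n: "leaf V1 E1 n w"
      "{gi (Phi m'), gi (Psi m')} = {Phi n, Psi n} \<or> {gi (Chi u'), gi (Psi u')} = {Phi n, Psi n}"
      using w1(2,3) unfolding star_pair_def \<open>w1 = w\<close> by metis
    then have "Phi n \<in> {gi (Phi m'), gi (Psi m'), gi (Chi u'), gi (Psi u')}" by blast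
    then have "g (Phi n) \<in> {g (gi (Phi m')), g (gi (Psi m')), g (gi (Chi u')), g (gi (Psi u'))}"
      by auto
    then have gn: "g (Phi n) \<in> {Phi m', Psi m', Chi u', Psi u'}" using L by (simp add: ggi)
    \<comment> \<open>The image of the row of \<open>n\<close> contains a mixed pair, so it is the
      cocycle of \<open>l'\<close>. But \<open>g (Phi n)\<close> lies in the cocycle of
      \<open>m'\<close>, which is disjoint from it.\<close>
    let ?D = "{Phi n, Psi n, Chi w, Psi w}"
    have "cocycle V2 E2 (g ` ?D)" using cycle_iso_cocycle[OF g pendant_cocycle(1)[OF ac(1) n(1)]] .
    moreover have "?D \<subseteq> W V1" using L leafD[OF ac(1) n(1)] by simp
    then have "card (g ` ?D) = card ?D" using cycle_isoD(2)[OF g] by (meson card_image inj_on_subset)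
    then have "card (g ` ?D) = 4" using pendant_cocycle(2)[OF ac(1) n(1)] by simp
    moreover have "{Phi l', Chi w'} \<subseteq> {g (Chi w), g (Psi w)} \<or> {Psi l', Psi w'} \<subseteq> {g (Chi w), g (Psi w)}"
      using X unfolding crossed_pair_def by blast
    then have "{Phi l', Chi w'} \<subseteq> g ` ?D \<or> {Psi l', Psi w'} \<subseteq> g ` ?D" by auto
    ultimately have "g ` ?D = {Phi l', Psi l', Chi w', Psi w'}"
      using mixed_pair_cocycle[OF P(2) _ _ l'] by blast
    moreover have "g (Phi n) \<in> g ` ?D" by simp
    ultimately have "g (Phi n) \<in> {Phi l', Psi l', Chi w', Psi w'}" by metis
    then show thesis using gn disj by blast
  next
    fix k z n y assume *: "supp V1 E1 (gi (Phi u')) = {y}" "leaf V1 E1 k z"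
      "nbrs V1 E1 z = {k, y}" "gi ` {Phi m', Psi m', Chi u', Psi u'} = {Phi k, Psi k, Chi z, Psi z}"
    have "y = w" using *(1) supp_gi by simp
    moreover have "g ` {Phi k, Psi k, Chi z, Psi z} = {Phi m', Psi m', Chi u', Psi u'}"
      unfolding *(4)[symmetric] image_image using L by (simp add: ggi)
    ultimately show thesis using that *(2,3) by blast
  qed
qed

text \<open>As \<open>y\<close> differs from \<open>u\<close>, only the exceptional alternative of
  \<open>pendant_split\<close> is left.\<close>

lemma crossed_second_neighbour:
  assumes P: "proper_forest V1 E1" "proper_forest V2 E2"
    and g: "cycle_iso V1 E1 V2 E2 g" and k: "leaf V1 E1 k z"
    and m: "leaf V2 E2 m u"
    and D: "g ` {Phi k, Psi k, Chi z, Psi z} = {Phi m, Psi m, Chi u, Psi u}"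
    and y: "supp V2 E2 (g (Phi z)) = {y}" "y \<noteq> u"
  shows "nbrs V2 E2 u = {m, y}"
    "crossed_pair m u (g (Phi k)) (g (Psi k)) (g (Chi z)) (g (Psi z))"
proof -
  note ac = proper_forestD(1)[OF P(1)] proper_forestD(1)[OF P(2)]
  note L = leafD[OF ac(1) k] leafD[OF ac(2) m]
  have dist: "distinct [g (Phi k), g (Psi k), g (Chi z), g (Psi z)]"
    using cycle_iso_eq_iff[OF g] L by auto
  have mem: "g (Phi k) \<in> {Phi m, Psi m, Chi u, Psi u}" "g (Psi k) \<in> {Phi m, Psi m, Chi u, Psi u}"
    unfolding D[symmetric] by auto
  have eq: "{g (Phi k), g (Psi k), g (Chi z), g (Psi z)} = {Phi m, Psi m, Chi u, Psi u}"
    using D by simp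
  have sp: "nbrs V2 E2 u = {m, y} \<and>
      ({g (Phi k), g (Psi k)} = {Phi m, Chi u} \<or> {g (Phi k), g (Psi k)} = {Psi m, Psi u})"
    using pendant_split[OF P(2) m mem _ pendant_supp_image(1)[OF ac(1) g k, unfolded y(1), symmetric]]
      dist y(2) by auto
  then show "nbrs V2 E2 u = {m, y}" by simp
  have compl: "{g (Chi z), g (Psi z)} = {r, s}"
    if "{g (Phi k), g (Psi k)} = {p, q}" "{Phi m, Psi m, Chi u, Psi u} = {p, q, r, s}"
      "distinct [p, q, r, s]" for p q r s
    using complement_pair[OF _ that(1) dist that(3)] eq that(2) by simp
  from sp consider "{g (Phi k), g (Psi k)} = {Phi m, Chi u}" | "{g (Phi k), g (Psi k)} = {Psi m, Psi u}"
    by blast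
  then show "crossed_pair m u (g (Phi k)) (g (Psi k)) (g (Chi z)) (g (Psi z))"
  proof cases
    case 1
    have "{g (Chi z), g (Psi z)} = {Psi m, Psi u}" using compl[OF 1] L by auto
    then show ?thesis using 1 by (simp add: crossed_pair_def)
  next
    case 2
    have "{g (Chi z), g (Psi z)} = {Phi m, Chi u}" using compl[OF 2] L by auto
    then show ?thesis using 2 by (simp add: crossed_pair_def)
  qed
qed

text \<open>Here the components of \<^term>\<open>l\<close> and \<^term>\<open>l'\<close> turn out to be paths on four vertices, none of which
  is constrained by \<^const>\<open>keeps\<close>, so they can be matched arbitrarily and removed.\<close>

lemma realize_crossed:
  assumes P: "proper_forest V1 E1" "proper_forest V2 E2"
    and g: "cycle_iso V1 E1 V2 E2 g" and l: "leaf V1 E1 l w"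
    and u': "supp V2 E2 (g (Phi w)) = {u'}" and l': "leaf V2 E2 l' w'" and m': "leaf V2 E2 m' u'"
    and N: "nbrs V2 E2 w' = {l', u'}"
    and D: "g ` {Phi l, Psi l, Chi w, Psi w} = {Phi l', Psi l', Chi w', Psi w'}"
    and X: "crossed_pair l' w' (g (Phi l)) (g (Psi l)) (g (Chi w)) (g (Psi w))"
    and IH: "\<And>K1 K2. K1 \<subseteq> V1 \<Longrightarrow> K1 \<noteq> {} \<Longrightarrow> K2 \<subseteq> V2 \<Longrightarrow> cycle_iso (V1 - K1) E1 (V2 - K2) E2 g
      \<Longrightarrow> \<exists>f. realizes (V1 - K1) E1 (V2 - K2) E2 g f"
  shows "\<exists>f. realizes V1 E1 V2 E2 g f"
proof -
  note ac = proper_forestD(1)[OF P(1)] proper_forestD(1)[OF P(2)]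
  obtain k z where kz: "leaf V1 E1 k z" "nbrs V1 E1 z = {k, w}"
    "g ` {Phi k, Psi k, Chi z, Psi z} = {Phi m', Psi m', Chi u', Psi u'}"
    using crossed_other_pendant[OF P g l u' l' m' N D X] .
  note L = leafD[OF ac(1) l] leafD[OF ac(1) kz(1)] leafD[OF ac(2) l'] leafD[OF ac(2) m']
  note nc1 = leaf_not_centre[OF P(1)] and nc2 = leaf_not_centre[OF P(2)]
  have d1: "w \<noteq> z" using kz(2) nbrs_irrefl[OF ac(1), of z] by auto
  have d1': "l \<noteq> z" "k \<noteq> w" using nc1 l kz(1) by blast+
  have d1'': "l \<noteq> k" using d1 L by auto
  have d2: "w' \<noteq> u'" using N nbrs_irrefl[OF ac(2), of w'] by auto
  have d2': "l' \<noteq> u'" "m' \<noteq> w'" using nc2 l' m' by blast+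
  have d2'': "l' \<noteq> m'" using d2 L by auto
  obtain y where y: "supp V2 E2 (g (Phi z)) = {y}"
    using pendant_supp_image_single[OF P g kz(1)] by metis
  have "y \<noteq> u'"
  proof
    assume "y = u'"
    then have "supp V1 E1 (Phi z) = supp V1 E1 (Phi w)"
      using cycle_iso_supp_eq[OF g, of "Phi z" "Phi w"] u' y L by simp
    then show False using L d1 by (simp add: supp_Phi)
  qed
  note sec = crossed_second_neighbour[OF P g kz(1) m' kz(3) y this]
  \<comment> \<open>The second neighbour \<open>y\<close> of \<open>u'\<close> must be
    \<open>w'\<close>, so that \<open>l'\<close>, \<open>w'\<close>, \<open>u'\<close>,
    \<open>m'\<close> form a path.\<close>
  have "w' \<in> nbrs V2 E2 u'" using nbrs_sym[OF ac(2), of u' w'] N L by auto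
  then have yw: "y = w'" using sec(1) d2' by auto
  define gi where "gi = inv_into (W V1) g"
  have gi: "cycle_iso V2 E2 V1 E1 gi" unfolding gi_def by (rule cycle_iso_inv[OF g])
  have gig: "gi (g x) = x" if "x \<in> W V1" for x
    using cycle_isoD(2)[OF g] that by (simp add: gi_def)
  have "supp V1 E1 (gi (Phi w')) = supp V1 E1 (gi (g (Phi z)))"
    using cycle_iso_supp_eq[OF gi, of "Phi w'" "g (Phi z)"] cycle_isoD(4)[OF g, of "Phi z"] L y yw
    by (simp add: supp_Phi)
  then have z: "supp V1 E1 (gi (Phi w')) = {z}" using L by (simp add: gig supp_Phi)
  have "gi ` {Phi l', Psi l', Chi w', Psi w'} = {Phi l, Psi l, Chi w, Psi w}"
    unfolding D[symmetric] image_image using L by (simp add: gig)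
  \<comment> \<open>The same lemma for the inverse of \<open>g\<close> completes the path in the
    first forest.\<close>
  then have Nw: "nbrs V1 E1 w = {l, z}"
    using crossed_second_neighbour(1)[OF P(2,1) gi l' l _ z] d1 by auto
  \<comment> \<open>Neighbourhoods along the paths, in the orders \<open>l\<close>,
    \<open>w\<close>, \<open>z\<close>, \<open>k\<close> and \<open>l'\<close>, \<open>w'\<close>,
    \<open>u'\<close>, \<open>m'\<close>. They show that both vertex sets are whole
    components.\<close>
  note N1 = L(3) Nw kz(2) L(8) and N2 = L(13) N sec(1)[unfolded yw] L(18)
  let ?K1 = "{l, w, z, k}" and ?K2 = "{l', w', u', m'}"
  have K: "?K1 \<subseteq> V1" "?K2 \<subseteq> V2" using L by auto
  have cl1: "closed_part V1 E1 ?K1" using K(1) N1 unfolding closed_part_def by auto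
  have cl2: "closed_part V2 E2 ?K2" using K(2) N2 unfolding closed_part_def by auto
  \<comment> \<open>This catches the images of \<open>Phi w\<close>, \<open>Chi l\<close>,
    \<open>Phi z\<close> and \<open>Chi k\<close>, the elements of the path outside the two
    cocycles.\<close>
  have single: "x \<in> W ?K2" if x: "x \<in> W V2" "supp V2 E2 x = {u'} \<or> supp V2 E2 x = {w'}" for x
  proof -
    have "x = Phi u' \<or> x = Phi w' \<or> (\<exists>m. x = Chi m \<and> (leaf V2 E2 m u' \<or> leaf V2 E2 m w'))"
      using x supp_eq_singleton[OF ac(2) x(1)] N2 by blast
    moreover have "m \<in> ?K2" if "leaf V2 E2 m u' \<or> leaf V2 E2 m w'" for m
      using that leafD(4)[OF ac(2)] N2(2,3) by blast
    ultimately show ?thesis by auto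
  qed
  have "g ` W ?K1 \<subseteq> W ?K2"
  proof -
    have "W ?K1 \<subseteq> {Phi l, Psi l, Chi w, Psi w} \<union> {Phi k, Psi k, Chi z, Psi z}
        \<union> {Phi w, Chi l, Phi z, Chi k}" by (auto simp: W_def)
    then have "g ` W ?K1 \<subseteq> g ` {Phi l, Psi l, Chi w, Psi w} \<union> g ` {Phi k, Psi k, Chi z, Psi z}
        \<union> g ` {Phi w, Chi l, Phi z, Chi k}" by (simp only: image_Un[symmetric] image_mono)
    moreover have "g ` {Phi l, Psi l, Chi w, Psi w} \<subseteq> W ?K2" "g ` {Phi k, Psi k, Chi z, Psi z} \<subseteq> W ?K2"
      unfolding D kz(3) by auto
    moreover have "g ` {Phi w, Chi l, Phi z, Chi k} \<subseteq> W ?K2"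
    proof -
      have "g (Phi w) \<in> W ?K2" "g (Phi z) \<in> W ?K2"
        using L cycle_isoD(4)[OF g] u' y yw by (auto intro!: single)
      moreover have "g (Chi l) \<in> W ?K2" "g (Chi k) \<in> W ?K2"
        using L cycle_isoD(4)[OF g] u' y yw
          pendant_supp_image(2)[OF ac(1) g l] pendant_supp_image(2)[OF ac(1) g kz(1)]
        by (auto intro!: single)
      ultimately show ?thesis by simp
    qed
    ultimately show ?thesis by blast
  qed
  moreover have "card (g ` W ?K1) = card (W ?K1)"
    using cycle_isoD(2)[OF g] W_mono[OF K(1)] by (meson card_image inj_on_subset)
  moreover have "card ?K1 = 4" "card ?K2 = 4"
    using L d1 d1' d1'' d2 d2' d2'' by auto
  ultimately have gK: "g ` W ?K1 = W ?K2"
    by (intro card_subset_eq) (auto simp: finite_W card_W)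
  obtain h where h: "realizes (V1 - ?K1) E1 (V2 - ?K2) E2 g h"
    using IH[OF K(1) _ K(2) cycle_iso_remove_part[OF g ac cl1 cl2 gK]] by blast
  define f where "f v = (if v = l then l' else if v = w then w' else if v = z then u' else m')" for v
  have f: "f l = l'" "f w = w'" "f z = u'" "f k = m'"
    using L d1 d1' d1'' by (auto simp: f_def)
  have E1: "E1 u v \<longleftrightarrow> u \<in> nbrs V1 E1 v" if "u \<in> ?K1" "v \<in> ?K1" for u v
    using that K(1) acyclic_onD(2)[OF ac(1)] unfolding nbrs_def by blast
  have E2: "E2 u v \<longleftrightarrow> u \<in> nbrs V2 E2 v" if "u \<in> ?K2" "v \<in> ?K2" for u v
    using that K(2) acyclic_onD(2)[OF ac(2)] unfolding nbrs_def by blast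
  have "realizes ?K1 E1 ?K2 E2 g f"
    unfolding realizes_def
  proof (intro conjI)
    show "bij_betw f ?K1 ?K2"
      unfolding bij_betw_def inj_on_def using f L d2 d2' d2'' by auto
    have "u \<in> nbrs V1 E1 v \<longleftrightarrow> f u \<in> nbrs V2 E2 (f v)" if "u \<in> ?K1" "v \<in> ?K1" for u v
      using that L(5,10,15,20) d1 d1' d1'' d2 d2' d2''
      by (elim insertE emptyE; simp add: f N1 N2; blast?)
    moreover have "f u \<in> ?K2" if "u \<in> ?K1" for u using that f by auto
    ultimately show "\<forall>u\<in>?K1. \<forall>v\<in>?K1. E1 u v \<longleftrightarrow> E2 (f u) (f v)"
      using E1 E2 by metis
    have "\<not> keeps g v v'" if "v \<in> ?K1" for v v'
      using that crossed_pair_not_keeps[OF X L(15)] crossed_pair_not_keeps[OF sec(2) L(20)] by blast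
    then show "\<forall>v\<in>?K1. \<forall>v'\<in>?K2. keeps g v v' \<longrightarrow> f v = v'" by blast
  qed
  then show ?thesis using realizes_combine[OF ac g cl1 cl2 gK _ h] by blast
qed

section \<open>The theorem\<close>

text \<open>The induction is on the number of vertices and for all \<open>g\<close> at once, since
  \<open>g\<close> may be modified before vertices are removed. Isolated vertices and edge
  components go first, so that a leaf is chosen only in a proper forest.\<close>

lemma cycle_iso_imp_realizes:
  assumes "acyclic_on V1 E1" "acyclic_on V2 E2" "cycle_iso V1 E1 V2 E2 g"
  shows "\<exists>f. realizes V1 E1 V2 E2 g f"
  using assms
proof (induction "card V1" arbitrary: V1 V2 g rule: less_induct)
  case less
  note ac = less.prems(1,2) and g = less.prems(3)
  have fin: "finite V1" using acyclic_onD(1)[OF ac(1)] .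
  have IH: "\<exists>f. realizes (V1 - K1) E1 (V2 - K2) E2 h f"
    if "K1 \<subseteq> V1" "K1 \<noteq> {}" "cycle_iso (V1 - K1) E1 (V2 - K2) E2 h" for K1 K2 h
  proof -
    have "V1 - K1 \<subset> V1" using that(1,2) by blast
    then have "card (V1 - K1) < card V1" using fin by (rule psubset_card_mono[rotated])
    then show ?thesis
      using less.hyps that(3) acyclic_on_subset[OF ac(1)] acyclic_on_subset[OF ac(2)]
      by (meson Diff_subset)
  qed
  show ?case
  proof (cases "\<exists>v\<in>V1. nbrs V1 E1 v = {}")
    case True
    then obtain v where v: "v \<in> V1" "nbrs V1 E1 v = {}" by blast
    show ?thesis
      by (rule realize_isolated[OF ac g v]) (use v IH[of "{v}"] in blast)
  next
    case False
    then have ni1: "nbrs V1 E1 v \<noteq> {}" if "v \<in> V1" for v using that by blast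
    have ni2: "nbrs V2 E2 v \<noteq> {}" if "v \<in> V2" for v
      using cycle_iso_no_isolated[OF ac g ni1 that] .
    show ?thesis
    proof (cases "\<exists>a b. leaf V1 E1 a b \<and> leaf V1 E1 b a")
      case True
      then obtain a b where ab: "leaf V1 E1 a b" "leaf V1 E1 b a" by blast
      have "{a, b} \<subseteq> V1" using leafD[OF ac(1) ab(1)] by simp
      then show ?thesis
        by (intro realize_edge[OF ac g ni2 ab] IH) auto
    next
      case False
      then have P1: "proper_forest V1 E1" using ac(1) ni1 by (auto simp: proper_forest_def)
      have P2: "proper_forest V2 E2" using cycle_iso_proper_forest[OF P1 ac(2) g] .
      show ?thesis
      proof (cases "V1 = {}")
        case True
        then have "V2 = {}" using cycle_isoD(3)[OF g] by (auto simp: W_def)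
        then have "realizes V1 E1 V2 E2 g f" for f using True by (simp add: realizes_def bij_betw_def)
        then show ?thesis by blast
      next
        case False
        obtain l w where l: "leaf V1 E1 l w" using exists_leaf[OF ac(1) False ni1] .
        note L = leafD[OF ac(1) l]
        show ?thesis
        proof (rule pendant_image[OF P1 P2 g l])
          fix w' assume *: "supp V2 E2 (g (Phi w)) = {w'}"
            "star_pair V2 E2 w' (g (Phi l)) (g (Psi l))" "star_pair V2 E2 w' (g (Chi w)) (g (Psi w))"
          have "w' \<in> V2" using *(1) supp_subset[of V2 E2 "g (Phi w)"] by simp
          then show ?thesis
            by (rule realize_straight[OF ac g l _ *]) (use L IH[of "{l}"] in blast)
        next
          fix l' w' m' u' assume *: "supp V2 E2 (g (Phi w)) = {u'}" "leaf V2 E2 l' w'"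
            "leaf V2 E2 m' u'" "nbrs V2 E2 w' = {l', u'}"
            "g ` {Phi l, Psi l, Chi w, Psi w} = {Phi l', Psi l', Chi w', Psi w'}"
            "crossed_pair l' w' (g (Phi l)) (g (Psi l)) (g (Chi w)) (g (Psi w))"
          show ?thesis by (rule realize_crossed[OF P1 P2 g l *]) (rule IH)
        qed
      qed
    qed
  qed
qed

section \<open>Independent sets and the cycle space\<close>

text \<open>Over GF(2) a coefficient function amounts to the set of elements at which it is
  1.\<close>

lemma IAS_indep_iff:
  assumes "finite V"
  shows "IAS_indep V E S \<longleftrightarrow> S \<subseteq> W V \<and> (\<forall>T\<subseteq>S. zero_sum V E T \<longrightarrow> T = {})"
proof (cases "S \<subseteq> W V")
  case True
  then have fin: "finite S" using assms finite_W finite_subset by metis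
  have sum: "(\<Sum>x\<in>S. c x * IAS_col E x u) = (\<Sum>x\<in>{x \<in> S. c x = 1}. IAS_col E x u)" for c u
  proof -
    have "(\<Sum>x\<in>S. c x * IAS_col E x u) = (\<Sum>x\<in>S. if c x = 1 then IAS_col E x u else 0)"
      by (intro sum.cong) auto
    then show ?thesis using fin by (simp add: sum.inter_filter)
  qed
  have "IAS_indep V E S \<longleftrightarrow>
      (\<forall>c :: 'a welem \<Rightarrow> bit. zero_sum V E {x \<in> S. c x = 1} \<longrightarrow> {x \<in> S. c x = 1} = {})"
    unfolding IAS_indep_def zero_sum_def sum using True by auto
  also have "\<dots> \<longleftrightarrow> (\<forall>T\<subseteq>S. zero_sum V E T \<longrightarrow> T = {})"
  proof (intro iffI allI impI)
    fix T assume *: "\<forall>c :: 'a welem \<Rightarrow> bit. zero_sum V E {x \<in> S. c x = 1} \<longrightarrow> {x \<in> S. c x = 1} = {}"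
      and T: "T \<subseteq> S" "zero_sum V E T"
    have "{x \<in> S. bit_of (x \<in> T) = 1} = T" using T(1) by auto
    then show "T = {}" using *[rule_format, of "\<lambda>x. bit_of (x \<in> T)"] T(2) by simp
  next
    fix c :: "'a welem \<Rightarrow> bit"
    assume *: "\<forall>T\<subseteq>S. zero_sum V E T \<longrightarrow> T = {}" and z: "zero_sum V E {x \<in> S. c x = 1}"
    have "{x \<in> S. c x = 1} \<subseteq> S" by blast
    then show "{x \<in> S. c x = 1} = {}" using * z by blast
  qed
  finally show ?thesis using True by simp
qed (simp add: IAS_indep_def)

lemma zero_sum_Diff:
  assumes "finite S" "T \<subseteq> S" "zero_sum V E T"
  shows "zero_sum V E (S - T) \<longleftrightarrow> zero_sum V E S"
proof -
  have "(\<Sum>x\<in>S. IAS_col E x u) = (\<Sum>x\<in>S - T. IAS_col E x u) + (\<Sum>x\<in>T. IAS_col E x u)" for u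
    using sum.subset_diff[OF assms(2,1)] .
  then show ?thesis using assms(3) by (simp add: zero_sum_def)
qed

text \<open>A nonempty zero-sum set is split into a circuit, whose image is again a circuit and hence
  zero-sum, and a smaller zero-sum set.\<close>

lemma matroid_iso_zero_sum:
  assumes fin: "finite V1" "finite V2" and bij: "bij_betw g (W V1) (W V2)"
    and ind: "\<And>S. S \<subseteq> W V1 \<Longrightarrow> IAS_indep V1 E1 S \<longleftrightarrow> IAS_indep V2 E2 (g ` S)"
    and S: "S \<subseteq> W V1" "zero_sum V1 E1 S"
  shows "zero_sum V2 E2 (g ` S)"
  using S
proof (induction "card S" arbitrary: S rule: less_induct)
  case less
  have finS: "finite S" using less.prems(1) finite_W[OF fin(1)] finite_subset by blast
  have inj: "inj_on g (W V1)" and im: "g ` W V1 = W V2" using bij by (auto simp: bij_betw_def)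
  show ?case
  proof (cases "S = {}")
    case False
    define F where "F = {T. T \<subseteq> S \<and> T \<noteq> {} \<and> zero_sum V1 E1 T}"
    have "finite F" "F \<noteq> {}" using finS False less.prems(2) by (auto simp: F_def)
    then obtain C where C: "C \<in> F" "\<And>T. T \<in> F \<Longrightarrow> T \<subseteq> C \<Longrightarrow> T = C"
      using finite_has_minimal[of F] by metis
    have CS: "C \<subseteq> S" "C \<noteq> {}" "zero_sum V1 E1 C" using C(1) by (auto simp: F_def)
    have CW: "C \<subseteq> W V1" using CS less.prems(1) by blast
    have "\<not> IAS_indep V1 E1 C" using CS by (auto simp: IAS_indep_iff[OF fin(1)])
    then have "\<not> IAS_indep V2 E2 (g ` C)" using ind[OF CW] by simp
    moreover have "g ` C \<subseteq> W V2" using CW im by blast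
    ultimately obtain T where T: "T \<subseteq> g ` C" "zero_sum V2 E2 T" "T \<noteq> {}"
      by (auto simp: IAS_indep_iff[OF fin(2)])
    then obtain B where B: "B \<subseteq> C" "T = g ` B" by (auto simp: subset_image_iff)
    \<comment> \<open>By minimality of \<open>C\<close> a proper subset \<open>B\<close> would be
      independent, and so would be its image \<open>T\<close>.\<close>
    have "B = C"
    proof (rule ccontr)
      assume "B \<noteq> C"
      then have "D = {}" if "D \<subseteq> B" "zero_sum V1 E1 D" for D
        using C(2)[of D] that B(1) CS(1) by (auto simp: F_def)
      then have "IAS_indep V1 E1 B" using B(1) CW by (auto simp: IAS_indep_iff[OF fin(1)])
      then have "IAS_indep V2 E2 T" using ind[of B] B CW by auto
      then show False using T by (auto simp: IAS_indep_iff[OF fin(2)])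
    qed
    then have gC: "zero_sum V2 E2 (g ` C)" using T B by simp
    have "zero_sum V1 E1 (S - C)" using zero_sum_Diff[OF finS CS(1,3)] less.prems(2) by simp
    moreover have "card (S - C) < card S" using CS finS by (intro psubset_card_mono) auto
    ultimately have "zero_sum V2 E2 (g ` (S - C))" using less.hyps less.prems(1) by blast
    moreover have "g ` (S - C) = g ` S - g ` C"
      using inj less.prems(1) CW by (intro inj_on_image_set_diff) auto
    moreover have "g ` C \<subseteq> g ` S" using CS(1) by (rule image_mono)
    ultimately show ?thesis using zero_sum_Diff[OF _ _ gC, of "g ` S"] finS by simp
  qed (simp add: zero_sum_def)
qed

text \<open>The inverse of a matroid isomorphism is one too, so the one-way statement is used for
  \<open>g\<close> and for its inverse.\<close>

lemma matroid_iso_cycle_iso: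
  assumes fin: "finite V1" "finite V2" and bij: "bij_betw g (W V1) (W V2)"
    and ind: "\<And>S. S \<subseteq> W V1 \<Longrightarrow> IAS_indep V1 E1 S \<longleftrightarrow> IAS_indep V2 E2 (g ` S)"
  shows "cycle_iso V1 E1 V2 E2 g"
proof -
  let ?h = "inv_into (W V1) g"
  have im: "g ` W V1 = W V2" "inj_on g (W V1)" using bij by (auto simp: bij_betw_def)
  have ind': "IAS_indep V2 E2 T \<longleftrightarrow> IAS_indep V1 E1 (?h ` T)" if T: "T \<subseteq> W V2" for T
  proof -
    have "?h ` T \<subseteq> W V1" using T im(1) by (metis image_subsetI inv_into_into subsetD)
    then show ?thesis using ind[of "?h ` T"] T im(1) by (simp add: image_inv_into_cancel)
  qed
  have "zero_sum V1 E1 S" if S: "S \<subseteq> W V1" "zero_sum V2 E2 (g ` S)" for S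
  proof -
    have gS: "g ` S \<subseteq> W V2" using S(1) im(1) by blast
    have "zero_sum V1 E1 (?h ` g ` S)"
      using matroid_iso_zero_sum[OF fin(2,1) bij_betw_inv_into[OF bij] _ gS S(2)] ind' by blast
    then show ?thesis using inv_into_image_cancel[OF im(2) S(1)] by simp
  qed
  then show ?thesis
    unfolding cycle_iso_def using bij matroid_iso_zero_sum[OF fin bij ind] by blast
qed

lemma forest_acyclic_on: "forest V E \<Longrightarrow> acyclic_on V E"
  unfolding forest_def simple_graph_def acyclic_on_def by blast

text \<open>Relabelling by \<open>f\<close> carries each column to the corresponding one, row by
  row, and hence preserves zero-sum sets.\<close>

lemma graph_iso_imp_matroid_iso:
  assumes fin: "finite V1" "finite V2" and iso: "graph_iso V1 E1 V2 E2"
  shows "matroid_iso (W V1) (IAS_indep V1 E1) (W V2) (IAS_indep V2 E2)"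
proof -
  obtain f where f: "bij_betw f V1 V2" "\<And>u v. u \<in> V1 \<Longrightarrow> v \<in> V1 \<Longrightarrow> E1 u v \<longleftrightarrow> E2 (f u) (f v)"
    using iso by (auto simp: graph_iso_def)
  have inj: "inj_on f V1" and im: "f ` V1 = V2" using f(1) by (auto simp: bij_betw_def)
  let ?g = "map_welem f"
  have "inj_on ?g (W V1)"
    by (rule inj_onI) (auto elim!: W_cases simp: inj_on_eq_iff[OF inj])
  moreover have "?g ` W V1 = W V2"
    unfolding W_def im[symmetric] by (auto simp: image_Un image_image)
  ultimately have bij: "bij_betw ?g (W V1) (W V2)" by (simp add: bij_betw_def)
  have col: "IAS_col E2 (?g x) (f u) = IAS_col E1 x u" if "x \<in> W V1" "u \<in> V1" for x u
    using that by (auto elim!: W_cases simp: adj_def idm_def f(2) inj_on_eq_iff[OF inj])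
  have zs: "zero_sum V2 E2 (?g ` S) \<longleftrightarrow> zero_sum V1 E1 S" if S: "S \<subseteq> W V1" for S
  proof -
    have inj: "inj_on ?g S" using \<open>inj_on ?g (W V1)\<close> S inj_on_subset by blast
    have "(\<Sum>x\<in>?g ` S. IAS_col E2 x (f u)) = (\<Sum>x\<in>S. IAS_col E1 x u)" if "u \<in> V1" for u
      using S that col by (subst sum.reindex[OF inj]) (auto intro!: sum.cong)
    then show ?thesis unfolding zero_sum_def im[symmetric] by simp
  qed
  have "IAS_indep V1 E1 S \<longleftrightarrow> IAS_indep V2 E2 (?g ` S)" if S: "S \<subseteq> W V1" for S
  proof -
    have "?g ` S \<subseteq> W V2" using S \<open>?g ` W V1 = W V2\<close> by blast
    moreover have "(\<forall>T\<subseteq>?g ` S. zero_sum V2 E2 T \<longrightarrow> T = {}) \<longleftrightarrow>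
        (\<forall>T\<subseteq>S. zero_sum V2 E2 (?g ` T) \<longrightarrow> ?g ` T = {})"
      by (rule all_subset_image)
    moreover have "\<dots> \<longleftrightarrow> (\<forall>T\<subseteq>S. zero_sum V1 E1 T \<longrightarrow> T = {})"
      using zs S by (metis image_is_empty subset_trans)
    ultimately show ?thesis using S by (simp add: IAS_indep_iff[OF fin(1)] IAS_indep_iff[OF fin(2)])
  qed
  then show ?thesis using bij unfolding matroid_iso_def by blast
qed

theorem mainTheorem1:
  fixes V1 :: "'a set" and E1 :: "'a \<Rightarrow> 'a \<Rightarrow> bool"
    and V2 :: "'b set" and E2 :: "'b \<Rightarrow> 'b \<Rightarrow> bool"
  assumes "forest V1 E1" and "forest V2 E2"
  shows "graph_iso V1 E1 V2 E2 \<longleftrightarrow>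
         matroid_iso (W V1) (IAS_indep V1 E1) (W V2) (IAS_indep V2 E2)"
proof
  note ac = forest_acyclic_on[OF assms(1)] forest_acyclic_on[OF assms(2)]
  have fin: "finite V1" "finite V2" using acyclic_onD(1) ac by blast+
  show "matroid_iso (W V1) (IAS_indep V1 E1) (W V2) (IAS_indep V2 E2)" if "graph_iso V1 E1 V2 E2"
    using graph_iso_imp_matroid_iso[OF fin that] .
  assume "matroid_iso (W V1) (IAS_indep V1 E1) (W V2) (IAS_indep V2 E2)"
  then obtain g where "cycle_iso V1 E1 V2 E2 g"
    unfolding matroid_iso_def using matroid_iso_cycle_iso[OF fin] by blast
  then obtain f where "realizes V1 E1 V2 E2 g f"
    using cycle_iso_imp_realizes[OF ac] by blast
  then show "graph_iso V1 E1 V2 E2" by (auto simp: realizes_def graph_iso_def)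
qed

end
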